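(* Let $(n,2d)=(3,6)$ or $(n,2d)=(4,4)$. Suppose that $\ell$ spans an extreme ray of $\Sigma_{n,2d}^*$ that does not correspond to point evaluation, and let $f_1,\ldots,f_{n-1}$ be forms in the kernel $W_\ell\subset H_{n,d}$ of $Q_\ell$ intersecting transversely in $s=d^{n-1}$ points $\Gamma=\{\gamma_1,\ldots,\gamma_s\}\subset\mathbb{CP}^{n-1}$. Then the set $\Gamma$ includes at most $1$ complex conjugate pair (of non-real points) and the rest of the points in $\Gamma$ are real.
   Context: $H_{n,d}$ is the real vector space of real forms (homogeneous polynomials) of degree $d$ in $n$ variables. $\Sigma_{n,2d}=\{p\in H_{n,2d} : p=\sum_i q_i^2 \text{ for some } q_i\in H_{n,d}\}$, and $\Sigma_{n,2d}^*=\{\ell\in H_{n,2d}^* : \ell(p)\ge 0 \text{ for all } p\in\Sigma_{n,2d}\}$. For $\ell\in H_{n,2d}^*$, $Q_\ell$ is the quadratic form on $H_{n,d}$ given by $Q_\ell(f)=\ell(f^2)$. The functional $\ell$ corresponds to point evaluation if it is (up to a scalar multiple) $f\mapsto f(v)$ for some $v\in\mathbb{R}^n$. Forms $f_1,\ldots,f_{n-1}\in H_{n,d}$ intersect transversely if their common zero set in $\mathbb{CP}^{n-1}$ is finite and at each common zero their gradients are linearly independent; it then consists of exactly $d^{n-1}$ distinct points. *)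

theory Defs
  imports "HOL-Analysis.Analysis" "HOL-Analysis.Finite_Function_Topology"
begin

text \<open>
  A real polynomial maps each exponent vector (a finitely supported function from variable
  indices to exponents) to its coefficient.  The product is the convolution product of
  \<^theory>\<open>HOL-Library.Poly_Mapping\<close>, the real vector space structure the one of
  \<^theory>\<open>HOL-Analysis.Finite_Function_Topology\<close>.
\<close>

type_synonym rpoly = "(nat \<Rightarrow>\<^sub>0 nat) \<Rightarrow>\<^sub>0 real"

definition forms :: "nat \<Rightarrow> nat \<Rightarrow> rpoly set" where
  "forms n d = {p. \<forall>m \<in> Poly_Mapping.keys p.
     Poly_Mapping.keys m \<subseteq> {..<n} \<and> (\<Sum>i<n. Poly_Mapping.lookup m i) = d}"

definition peval :: "rpoly \<Rightarrow> (nat \<Rightarrow> 'a::real_field) \<Rightarrow> 'a" where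
  "peval p v = (\<Sum>m \<in> Poly_Mapping.keys p.
     of_real (Poly_Mapping.lookup p m) *
       (\<Prod>i \<in> Poly_Mapping.keys m. v i ^ Poly_Mapping.lookup m i))"

definition sos :: "nat \<Rightarrow> nat \<Rightarrow> rpoly set" where
  "sos n d = {p \<in> forms n (2 * d).
     \<exists>(k::nat) q. (\<forall>i<k. q i \<in> forms n d) \<and> p = (\<Sum>i<k. (q i)\<^sup>2)}"

text \<open>
  A linear functional on a space of forms is a HOL function that is linear on that space; its
  values elsewhere are irrelevant, so two functionals are the same when they agree on the space.
\<close>

definition form_dual :: "nat \<Rightarrow> nat \<Rightarrow> (rpoly \<Rightarrow> real) set" where
  "form_dual n e = {l. (\<forall>p \<in> forms n e. \<forall>q \<in> forms n e. l (p + q) = l p + l q) \<and>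
     (\<forall>c. \<forall>p \<in> forms n e. l (c *\<^sub>R p) = c * l p)}"

definition sos_dual :: "nat \<Rightarrow> nat \<Rightarrow> (rpoly \<Rightarrow> real) set" where
  "sos_dual n d = {l \<in> form_dual n (2 * d). \<forall>p \<in> sos n d. l p \<ge> 0}"

definition spans_extreme_ray :: "nat \<Rightarrow> nat \<Rightarrow> (rpoly \<Rightarrow> real) \<Rightarrow> bool" where
  "spans_extreme_ray n d l \<longleftrightarrow>
     l \<in> sos_dual n d \<and> (\<exists>p \<in> forms n (2 * d). l p \<noteq> 0) \<and>
     (\<forall>l1 \<in> sos_dual n d. \<forall>l2 \<in> sos_dual n d.
        (\<forall>p \<in> forms n (2 * d). l p = l1 p + l2 p) \<longrightarrow>
        (\<exists>c1 \<ge> 0. \<forall>p \<in> forms n (2 * d). l1 p = c1 * l p) \<and>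
        (\<exists>c2 \<ge> 0. \<forall>p \<in> forms n (2 * d). l2 p = c2 * l p))"

definition is_point_evaluation :: "nat \<Rightarrow> nat \<Rightarrow> (rpoly \<Rightarrow> real) \<Rightarrow> bool" where
  "is_point_evaluation n e l \<longleftrightarrow>
     (\<exists>(c::real) (v::nat \<Rightarrow> real). \<forall>p \<in> forms n e. l p = c * peval p v)"

definition quad_form :: "(rpoly \<Rightarrow> real) \<Rightarrow> rpoly \<Rightarrow> real" where
  "quad_form l f = l (f\<^sup>2)"

text \<open>
  The kernel of a quadratic form \<open>Q\<close> on \<open>V\<close> is the radical of its polar bilinear form, that is,
  the kernel of any symmetric matrix representing \<open>Q\<close>.
\<close>

definition polar_form :: "(rpoly \<Rightarrow> real) \<Rightarrow> rpoly \<Rightarrow> rpoly \<Rightarrow> real" where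
  "polar_form Q f g = (Q (f + g) - Q f - Q g) / 2"

definition qf_kernel :: "rpoly set \<Rightarrow> (rpoly \<Rightarrow> real) \<Rightarrow> rpoly set" where
  "qf_kernel V Q = {f \<in> V. \<forall>g \<in> V. polar_form Q f g = 0}"

text \<open>
  \<open>proj_space n\<close> is the projectivisation of \<open>n\<close>-dimensional complex space, hence projective space
  of dimension \<open>n - 1\<close>.  Vectors are functions vanishing from index \<open>n\<close> on, and a point is the set
  of all its homogeneous coordinate vectors.
\<close>

definition nonzero_vecs :: "nat \<Rightarrow> (nat \<Rightarrow> complex) set" where
  "nonzero_vecs n = {v. (\<forall>i\<ge>n. v i = 0) \<and> (\<exists>i<n. v i \<noteq> 0)}"

definition proj_rel :: "nat \<Rightarrow> ((nat \<Rightarrow> complex) \<times> (nat \<Rightarrow> complex)) set" where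
  "proj_rel n = {(u, v). u \<in> nonzero_vecs n \<and> v \<in> nonzero_vecs n \<and>
     (\<exists>c. c \<noteq> 0 \<and> v = (\<lambda>i. c * u i))}"

definition proj_space :: "nat \<Rightarrow> (nat \<Rightarrow> complex) set set" where
  "proj_space n = nonzero_vecs n // proj_rel n"

definition real_point :: "(nat \<Rightarrow> complex) set \<Rightarrow> bool" where
  "real_point P \<longleftrightarrow> (\<exists>v \<in> P. \<forall>i. v i \<in> \<real>)"

definition conj_point :: "(nat \<Rightarrow> complex) set \<Rightarrow> (nat \<Rightarrow> complex) set" where
  "conj_point P = (\<lambda>v i. cnj (v i)) ` P"

text \<open>The forms are \<open>f 1, \<dots>, f (n - 1)\<close>; other values of \<open>f\<close> are ignored.\<close>

definition common_zeros :: "nat \<Rightarrow> (nat \<Rightarrow> rpoly) \<Rightarrow> (nat \<Rightarrow> complex) set set" where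
  "common_zeros n f = {P \<in> proj_space n. \<forall>v \<in> P. \<forall>j \<in> {1..n - 1}. peval (f j) v = 0}"

definition gradient :: "rpoly \<Rightarrow> (nat \<Rightarrow> complex) \<Rightarrow> nat \<Rightarrow> complex" where
  "gradient p v i = deriv (\<lambda>z. peval p (v(i := z))) (v i)"

definition gradients_independent :: "nat \<Rightarrow> (nat \<Rightarrow> rpoly) \<Rightarrow> (nat \<Rightarrow> complex) \<Rightarrow> bool" where
  "gradients_independent n f v \<longleftrightarrow>
     (\<forall>c::nat \<Rightarrow> complex. (\<forall>i<n. (\<Sum>j\<in>{1..n - 1}. c j * gradient (f j) v i) = 0) \<longrightarrow>
        (\<forall>j\<in>{1..n - 1}. c j = 0))"

definition intersect_transversely :: "nat \<Rightarrow> (nat \<Rightarrow> rpoly) \<Rightarrow> bool" where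
  "intersect_transversely n f \<longleftrightarrow> finite (common_zeros n f) \<and>
     (\<forall>P \<in> common_zeros n f. \<forall>v \<in> P. gradients_independent n f v)"

lemma equiv_proj_rel: "equiv (nonzero_vecs n) (proj_rel n)"
proof (rule equivI)
  show "refl_on (nonzero_vecs n) (proj_rel n)"
    by (auto simp: refl_on_def proj_rel_def intro!: exI[of _ 1])
  show "sym (proj_rel n)"
  proof (rule symI)
    fix u v assume "(u, v) \<in> proj_rel n"
    then obtain c where c: "u \<in> nonzero_vecs n" "v \<in> nonzero_vecs n" "c \<noteq> 0" "v = (\<lambda>i. c * u i)"
      by (auto simp: proj_rel_def)
    then have "u = (\<lambda>i. inverse c * v i)" by auto
    with c show "(v, u) \<in> proj_rel n"
      unfolding proj_rel_def using nonzero_imp_inverse_nonzero by blast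
  qed
  show "trans (proj_rel n)"
  proof (rule transI)
    fix u v w assume "(u, v) \<in> proj_rel n" "(v, w) \<in> proj_rel n"
    then obtain b c where bc: "u \<in> nonzero_vecs n" "w \<in> nonzero_vecs n" "b \<noteq> 0" "c \<noteq> 0"
      "w = (\<lambda>i. c * (b * u i))"
      by (auto simp: proj_rel_def)
    then have "c * b \<noteq> 0" "w = (\<lambda>i. (c * b) * u i)" by (auto simp: mult.assoc)
    with bc show "(u, w) \<in> proj_rel n" unfolding proj_rel_def by blast
  qed
  show "proj_rel n \<subseteq> nonzero_vecs n \<times> nonzero_vecs n" by (auto simp: proj_rel_def)
qed

lemma peval_scale:
  assumes "p \<in> forms n d"
  shows "peval p (\<lambda>i. c * v i) = c ^ d * peval p v"
proof -
  have "(\<Prod>i\<in>Poly_Mapping.keys m. (c * v i) ^ Poly_Mapping.lookup m i) =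
      c ^ d * (\<Prod>i\<in>Poly_Mapping.keys m. v i ^ Poly_Mapping.lookup m i)"
    if "m \<in> Poly_Mapping.keys p" for m
  proof -
    have "(\<Sum>i\<in>Poly_Mapping.keys m. Poly_Mapping.lookup m i) = (\<Sum>i<n. Poly_Mapping.lookup m i)"
      using assms that by (intro sum.mono_neutral_left) (auto simp: forms_def in_keys_iff)
    also have "\<dots> = d" using assms that by (auto simp: forms_def)
    finally show ?thesis
      by (simp add: power_mult_distrib prod.distrib flip: power_sum)
  qed
  then show ?thesis
    by (simp add: peval_def sum_distrib_left mult.left_commute)
qed

end

theory Submission
  imports Defs Jordan_Normal_Form.Determinant
begin

text \<open>
  Normalise the points of \<open>\<Gamma>\<close> by a real linear form and call the resulting set of vectors \<open>S\<close>.  Write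
  \<open>f\<^sub>i(x) - f\<^sub>i(y) = (\<Sum>j. \<theta>\<^sub>i\<^sub>j(x, y) (x\<^sub>j - y\<^sub>j))\<close> and let \<open>D(x, y)\<close> be the determinant of the matrix
  \<open>\<theta>\<close> bordered by the linear form.  It vanishes at distinct points of \<open>S\<close> but not on the diagonal, and
  its part of top degree \<open>d + 1\<close> in \<open>x\<close> does not depend on \<open>y\<close>.  As \<open>dim H\<^sub>n\<^sub>,\<^sub>d - (n - 1) = |S| - 1\<close>,
  the forms of degree \<open>d\<close> satisfy a linear relation \<open>(\<Sum>p\<in>S. u\<^sub>p g(p)) = 0\<close>; pairing it with \<open>D(\<cdot>, q)\<close>
  shows that \<open>u\<^sub>q D(q, q)\<close> is constant.  So the relation is unique and all its coefficients are nonzero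
  (Cayley-Bacharach), and all values subject to it are interpolated by forms of degree \<open>d\<close>.

  Taking derivatives at the points of \<open>S\<close>, all syzygies of degree \<open>d\<close> between the \<open>f\<^sub>i\<close> are seen to be
  trivial, and a dimension count then shows that every form of degree \<open>2d\<close> vanishing on \<open>S\<close> lies in the
  ideal of the \<open>f\<^sub>i\<close>.  Hence \<open>\<ell>(g) = (\<Sum>p\<in>S. \<mu>\<^sub>p g(p))\<close>.  Each conjugate pair with \<open>\<mu>\<^sub>p \<noteq> 0\<close> contributes a
  negative square, and the single relation \<open>u\<close> can compensate for only one of them.  If \<open>\<mu>\<^sub>p = 0\<close>
  at a non-real point, the value there is free to absorb the relation, so the other weights are
  nonnegative at real points and zero at non-real ones; then \<open>\<ell>\<close> is a nonnegative combination of real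
  point evaluations and by extremality a single one of them.
\<close>

subsection \<open>Polynomials and spaces of forms\<close>

lemma lookup_scaleR [simp]:
  "Poly_Mapping.lookup (c *\<^sub>R p) m = c * Poly_Mapping.lookup (p :: 'a \<Rightarrow>\<^sub>0 real) m"
proof -
  have "finite {i. c * Poly_Mapping.lookup p i \<noteq> 0}"
    by (rule finite_subset[OF _ finite_lookup[of p]]) auto
  then show ?thesis by (simp add: scaleR_poly_mapping_def)
qed

lemma scaleR_single: "c *\<^sub>R Poly_Mapping.single m (a::real) = Poly_Mapping.single m (c * a)"
  by (rule poly_mapping_eqI) (simp add: lookup_single when_def)

lemma scaleR_conv_mult: "c *\<^sub>R (p :: rpoly) = Poly_Mapping.single 0 c * p"
  by (rule poly_mapping_eqI) (simp add: mult_map_scale_conv_mult[symmetric] Poly_Mapping.map.rep_eq when_def)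

lemma scaleR_mult_right: "p * (c *\<^sub>R q) = c *\<^sub>R (p * q :: rpoly)"
  by (simp add: scaleR_conv_mult mult.left_commute)

lemma poly_mapping_eq_sum_single:
  "(p :: rpoly) = (\<Sum>m\<in>Poly_Mapping.keys p. Poly_Mapping.lookup p m *\<^sub>R Poly_Mapping.single m 1)"
  by (rule poly_mapping_eqI)
    (auto simp: lookup_sum lookup_single when_def scaleR_single sum.delta in_keys_iff)

section \<open>Evaluation of polynomials as a ring homomorphism\<close>

definition meval :: "(nat \<Rightarrow>\<^sub>0 nat) \<Rightarrow> (nat \<Rightarrow> 'a::real_field) \<Rightarrow> 'a" where
  "meval m v = (\<Prod>i\<in>Poly_Mapping.keys m. v i ^ Poly_Mapping.lookup m i)"

lemma meval_superset:
  assumes "finite K" "Poly_Mapping.keys m \<subseteq> K"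
  shows "meval m v = (\<Prod>i\<in>K. v i ^ Poly_Mapping.lookup m i)"
  unfolding meval_def using assms by (intro prod.mono_neutral_left) (auto simp: in_keys_iff)

lemma meval_add: "meval (m + m') v = meval m v * meval m' v"
proof -
  let ?K = "Poly_Mapping.keys m \<union> Poly_Mapping.keys m'"
  have "Poly_Mapping.keys (m + m') \<subseteq> ?K" by (rule keys_add)
  then show ?thesis
    by (simp add: meval_superset[of ?K] lookup_add power_add prod.distrib)
qed

lemma meval_0 [simp]: "meval 0 v = 1"
  by (simp add: meval_def)

lemma meval_single: "meval (Poly_Mapping.single i k) v = v i ^ k"
  by (simp add: meval_def)

lemma peval_superset:
  assumes "finite K" "Poly_Mapping.keys p \<subseteq> K"
  shows "peval p v = (\<Sum>m\<in>K. of_real (Poly_Mapping.lookup p m) * meval m v)"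
  unfolding peval_def meval_def[symmetric] using assms
  by (intro sum.mono_neutral_left) (auto simp: in_keys_iff)

lemma peval_single [simp]: "peval (Poly_Mapping.single m c) v = of_real c * meval m v"
  by (simp add: peval_superset[of "{m}"])

lemma peval_0 [simp]: "peval 0 v = 0"
  by (simp add: peval_def)

lemma peval_1 [simp]: "peval 1 v = 1"
  by (simp add: peval_def)

lemma peval_add [simp]: "peval (p + q) v = peval p v + peval q v"
proof -
  let ?K = "Poly_Mapping.keys p \<union> Poly_Mapping.keys q"
  have "Poly_Mapping.keys (p + q) \<subseteq> ?K" by (rule keys_add)
  then show ?thesis
    by (simp add: peval_superset[of ?K] lookup_add distrib_right sum.distrib)
qed

lemma peval_scaleR [simp]: "peval (c *\<^sub>R p) v = of_real c * peval p v"
proof -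
  have "Poly_Mapping.keys (c *\<^sub>R p) \<subseteq> Poly_Mapping.keys p"
    by (auto simp: in_keys_iff)
  then show ?thesis
    by (simp add: peval_superset[of "Poly_Mapping.keys p"] sum_distrib_left mult.assoc)
qed

lemma peval_uminus [simp]: "peval (- p) v = - peval p v"
  using peval_scaleR[of "-1" p v] by simp

lemma peval_diff [simp]: "peval (p - q) v = peval p v - peval q v"
  using peval_add[of p "- q" v] by simp

lemma peval_sum [simp]: "peval (sum p A) v = (\<Sum>a\<in>A. peval (p a) v)"
  by (induction A rule: infinite_finite_induct) auto

lemma peval_eq_sum:
  "peval p v = (\<Sum>m\<in>Poly_Mapping.keys p. of_real (Poly_Mapping.lookup p m) * meval m v)"
  by (rule peval_superset) auto

lemma peval_mult [simp]: "peval (p * q) v = peval p v * peval q v"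
proof -
  have "p * q = (\<Sum>m\<in>Poly_Mapping.keys p. \<Sum>m'\<in>Poly_Mapping.keys q.
      Poly_Mapping.single (m + m') (Poly_Mapping.lookup p m * Poly_Mapping.lookup q m'))"
    by (subst poly_mapping_eq_sum_single[of p], subst poly_mapping_eq_sum_single[of q])
      (simp add: sum_product scaleR_single mult_single)
  then show ?thesis
    unfolding peval_eq_sum[of p] peval_eq_sum[of q] sum_product
    by (simp add: meval_add mult_ac)
qed

lemma peval_power [simp]: "peval (p ^ k) v = peval p v ^ k"
  by (induction k) auto

lemma peval_cnj: "peval p (\<lambda>i. cnj (v i)) = cnj (peval p v)"
  by (simp add: peval_def)

lemma peval_of_real: "peval p (\<lambda>i. of_real (v i) :: 'a::real_field) = of_real (peval p v)"
  by (simp add: peval_def)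

section \<open>Monomials of fixed degree and the dimension of the spaces of forms\<close>

definition mons :: "nat \<Rightarrow> nat \<Rightarrow> (nat \<Rightarrow>\<^sub>0 nat) set" where
  "mons n d = {m. Poly_Mapping.keys m \<subseteq> {..<n} \<and> (\<Sum>i<n. Poly_Mapping.lookup m i) = d}"

lemma forms_iff: "p \<in> forms n d \<longleftrightarrow> Poly_Mapping.keys p \<subseteq> mons n d"
  by (auto simp: forms_def mons_def)

text \<open>Stars and bars: listing the exponents identifies these monomials with the lists of
  length \<open>n\<close> and sum \<open>d\<close>.\<close>

lemma mons_card: "finite (mons n d)" "card (mons n d) = (d + n - 1) choose d"
proof -
  let ?L = "{l::nat list. length l = n \<and> sum_list l = d}"
  have "bij_betw (\<lambda>m. map (Poly_Mapping.lookup m) [0..<n]) (mons n d) ?L"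
  proof (rule bij_betwI')
    fix m m' assume m: "m \<in> mons n d" "m' \<in> mons n d"
    show "(map (Poly_Mapping.lookup m) [0..<n] = map (Poly_Mapping.lookup m') [0..<n]) = (m = m')"
    proof
      assume eq: "map (Poly_Mapping.lookup m) [0..<n] = map (Poly_Mapping.lookup m') [0..<n]"
      show "m = m'"
      proof (rule poly_mapping_eqI)
        fix k
        show "Poly_Mapping.lookup m k = Poly_Mapping.lookup m' k"
        proof (cases "k < n")
          case False
          then have "k \<notin> Poly_Mapping.keys m" "k \<notin> Poly_Mapping.keys m'"
            using m by (auto simp: mons_def)
          then show ?thesis by (simp add: in_keys_iff)
        qed (use eq in auto)
      qed
    qed simp
  next
    fix m assume "m \<in> mons n d"
    then show "map (Poly_Mapping.lookup m) [0..<n] \<in> ?L"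
      by (auto simp: mons_def sum_list_sum_nth atLeast0LessThan)
  next
    fix l assume l: "l \<in> ?L"
    define m where "m = Abs_poly_mapping (\<lambda>i. if i < n then l ! i else 0)"
    have lk: "Poly_Mapping.lookup m i = (if i < n then l ! i else 0)" for i
      unfolding m_def by (subst lookup_Abs_poly_mapping) auto
    have "m \<in> mons n d"
      using l by (auto simp: mons_def in_keys_iff lk sum_list_sum_nth atLeast0LessThan split: if_splits)
    moreover have "l = map (Poly_Mapping.lookup m) [0..<n]"
      using l by (auto simp: lk intro: nth_equalityI)
    ultimately show "\<exists>m\<in>mons n d. l = map (Poly_Mapping.lookup m) [0..<n]" by blast
  qed
  then have "card (mons n d) = card ?L" "finite (mons n d) = finite ?L"
    by (auto simp: bij_betw_same_card bij_betw_finite)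
  moreover have "finite ?L"
  proof (rule finite_subset)
    show "?L \<subseteq> {xs. set xs \<subseteq> {..d} \<and> length xs = n}"
      by (auto intro: member_le_sum_list)
  qed (rule finite_lists_length_eq, simp)
  ultimately show "finite (mons n d)" "card (mons n d) = (d + n - 1) choose d"
    by (auto simp: card_length_sum_list)
qed

lemma subspace_forms: "subspace (forms n d)"
proof (rule subspaceI)
  fix p q :: rpoly and c :: real
  show "(0 :: rpoly) \<in> forms n d" by (simp add: forms_iff)
  show "p + q \<in> forms n d" if "p \<in> forms n d" "q \<in> forms n d"
    using keys_add[of p q] that unfolding forms_iff by blast
  show "c *\<^sub>R p \<in> forms n d" if "p \<in> forms n d"
    using that unfolding forms_iff by (auto simp: in_keys_iff)
qed

lemmas forms_0 [simp] = subspace_0[OF subspace_forms]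
lemmas forms_add = subspace_add[OF subspace_forms]
lemmas forms_diff = subspace_diff[OF subspace_forms]
lemmas forms_scaleR = subspace_scale[OF subspace_forms]
lemmas forms_sum = subspace_sum[OF subspace_forms]

lemma single_forms: "m \<in> mons n d \<Longrightarrow> Poly_Mapping.single m c \<in> forms n d"
  by (auto simp: forms_iff)

abbreviation monomials :: "nat \<Rightarrow> nat \<Rightarrow> rpoly set" where
  "monomials n d \<equiv> (\<lambda>m. Poly_Mapping.single m 1) ` mons n d"

lemma forms_eq_span: "forms n d = span (monomials n d)"
proof
  show "forms n d \<subseteq> span (monomials n d)"
  proof
    fix p assume "p \<in> forms n d"
    then have "Poly_Mapping.single m 1 \<in> monomials n d" if "m \<in> Poly_Mapping.keys p" for m
      using that by (auto simp: forms_iff)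
    then show "p \<in> span (monomials n d)"
      by (subst poly_mapping_eq_sum_single) (intro span_sum span_scale span_base)
  qed
  show "span (monomials n d) \<subseteq> forms n d"
    by (rule span_minimal) (auto intro: single_forms subspace_forms)
qed

lemma inj_single1: "inj (\<lambda>m. Poly_Mapping.single m (1::real))"
proof (rule injI)
  fix m m' :: 'a assume "Poly_Mapping.single m (1::real) = Poly_Mapping.single m' 1"
  then have "Poly_Mapping.lookup (Poly_Mapping.single m (1::real)) m = Poly_Mapping.lookup (Poly_Mapping.single m' 1) m"
    by simp
  then show "m = m'" by (auto simp: lookup_single when_def split: if_splits)
qed

lemma independent_monomials: "independent (monomials n d)"
proof (rule independent_if_scalars_zero)
  show "finite (monomials n d)" by (simp add: mons_card)
next
  fix c x assume eq: "(\<Sum>x\<in>monomials n d. c x *\<^sub>R x) = 0" and x: "x \<in> monomials n d"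
  then obtain m where m: "m \<in> mons n d" "x = Poly_Mapping.single m 1" by auto
  have "0 = Poly_Mapping.lookup (\<Sum>x\<in>monomials n d. c x *\<^sub>R x) m" using eq by simp
  also have "\<dots> = (\<Sum>m'\<in>mons n d. c (Poly_Mapping.single m' 1) * (1 when m' = m))"
    by (simp add: sum.reindex inj_on_subset[OF inj_single1] lookup_sum lookup_single)
  also have "\<dots> = (\<Sum>m'\<in>mons n d. if m' = m then c x else 0)"
    by (rule sum.cong) (auto simp: m when_def)
  also have "\<dots> = c x" using m by (simp add: mons_card)
  finally show "c x = 0" by simp
qed

lemma dim_forms: "dim (forms n d) = (d + n - 1) choose d"
  by (simp add: forms_eq_span dim_span dim_eq_card_independent[OF independent_monomials]
      card_image inj_on_subset[OF inj_single1] mons_card)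

lemma mons_add: "m \<in> mons n j \<Longrightarrow> m' \<in> mons n k \<Longrightarrow> m + m' \<in> mons n (j + k)"
  using keys_add[of m m'] by (auto simp: mons_def lookup_add sum.distrib)

lemma forms_mult:
  assumes "p \<in> forms n j" "q \<in> forms n k"
  shows "p * q \<in> forms n (j + k)"
  unfolding forms_iff
proof
  fix m assume "m \<in> Poly_Mapping.keys (p * q)"
  then obtain a b where "m = a + b" "a \<in> Poly_Mapping.keys p" "b \<in> Poly_Mapping.keys q"
    using keys_mult[of p q] by blast
  then show "m \<in> mons n (j + k)"
    using assms unfolding forms_iff by (auto intro: mons_add)
qed

lemma forms_power: "p \<in> forms n j \<Longrightarrow> p ^ k \<in> forms n (k * j)"
proof (induction k)
  case 0
  show ?case by (auto simp: forms_iff mons_def)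
qed (auto simp: forms_mult)

lemma forms_square: "p \<in> forms n d \<Longrightarrow> p\<^sup>2 \<in> forms n (2 * d)"
  by (rule forms_power)

lemma mons_var: "i < n \<Longrightarrow> Poly_Mapping.single i 1 \<in> mons n 1"
  by (auto simp: mons_def lookup_single when_def)

text \<open>Peeling one variable off a monomial is the induction step for the difference
  quotients.\<close>

lemma mons_SucE:
  assumes "m \<in> mons n (Suc d)"
  obtains i m' where "i < n" "m' \<in> mons n d" "m = Poly_Mapping.single i 1 + m'"
proof -
  have "\<exists>i\<in>{..<n}. Poly_Mapping.lookup m i \<noteq> 0"
  proof (rule ccontr)
    assume "\<not> ?thesis"
    then have "(\<Sum>i<n. Poly_Mapping.lookup m i) = 0" by simp
    then show False using assms by (simp add: mons_def)
  qed
  then obtain i where i: "i < n" "Poly_Mapping.lookup m i \<noteq> 0" by auto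
  define m' where "m' = m - Poly_Mapping.single i 1"
  have m: "m = Poly_Mapping.single i 1 + m'"
    using i by (intro poly_mapping_eqI) (auto simp: m'_def lookup_add lookup_minus lookup_single when_def)
  have "Poly_Mapping.keys m' \<subseteq> {..<n}"
  proof
    fix x assume "x \<in> Poly_Mapping.keys m'"
    then have "x \<in> Poly_Mapping.keys m" by (subst m) (simp add: in_keys_iff lookup_add)
    then show "x \<in> {..<n}" using assms by (auto simp: mons_def)
  qed
  moreover have "(\<Sum>i<n. Poly_Mapping.lookup m' i) = d"
  proof -
    have "Suc d = (\<Sum>j<n. Poly_Mapping.lookup m j)" using assms by (simp add: mons_def)
    also have "\<dots> = 1 + (\<Sum>i<n. Poly_Mapping.lookup m' i)"
      using i(1) by (subst m) (simp add: lookup_add sum.distrib lookup_single when_def)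
    finally show ?thesis by simp
  qed
  ultimately show thesis using that[OF i(1) _ m] by (simp add: mons_def)
qed

subsection \<open>Complex forms on an affine slice and difference quotients\<close>

text \<open>\<open>rpoly\<close> has real coefficients only, so a complex form is encoded by the
  polynomial function of a real form plus \<open>\<i>\<close> times that of another one.\<close>

definition cforms :: "nat \<Rightarrow> nat \<Rightarrow> ((nat \<Rightarrow> complex) \<Rightarrow> complex) set" where
  "cforms n k = {F. \<exists>a\<in>forms n k. \<exists>b\<in>forms n k. F = (\<lambda>v. peval a v + \<i> * peval b v)}"

lemma cformsI: "a \<in> forms n k \<Longrightarrow> b \<in> forms n k \<Longrightarrow> (\<lambda>v. peval a v + \<i> * peval b v) \<in> cforms n k"
  by (auto simp: cforms_def)

lemma cforms_peval: "a \<in> forms n k \<Longrightarrow> peval a \<in> cforms n k"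
  using cformsI[of a n k 0] by (simp add: eta_contract_eq)

lemma cforms_const: "(\<lambda>_. z) \<in> cforms n 0"
proof -
  have "Poly_Mapping.single 0 x \<in> forms n 0" for x
    by (rule single_forms) (simp add: mons_def)
  from cformsI[OF this[of "Re z"] this[of "Im z"]] show ?thesis
    by (simp add: complex_eq[symmetric])
qed

lemma cforms_add:
  assumes "F \<in> cforms n k" "G \<in> cforms n k"
  shows "(\<lambda>v. F v + G v) \<in> cforms n k"
proof -
  obtain a b a' b' where "a \<in> forms n k" "b \<in> forms n k" "F = (\<lambda>v. peval a v + \<i> * peval b v)"
    "a' \<in> forms n k" "b' \<in> forms n k" "G = (\<lambda>v. peval a' v + \<i> * peval b' v)"
    using assms unfolding cforms_def by auto
  then show ?thesis
    using cformsI[of "a + a'" n k "b + b'"] by (simp add: forms_add algebra_simps)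
qed

lemma cforms_mult:
  assumes "F \<in> cforms n j" "G \<in> cforms n k"
  shows "(\<lambda>v. F v * G v) \<in> cforms n (j + k)"
proof -
  obtain a b a' b' where "a \<in> forms n j" "b \<in> forms n j" "F = (\<lambda>v. peval a v + \<i> * peval b v)"
    "a' \<in> forms n k" "b' \<in> forms n k" "G = (\<lambda>v. peval a' v + \<i> * peval b' v)"
    using assms unfolding cforms_def by auto
  moreover from this have "(\<lambda>v. peval (a * a' - b * b') v + \<i> * peval (a * b' + b * a') v) \<in> cforms n (j + k)"
    by (intro cformsI forms_add forms_diff forms_mult)
  ultimately show ?thesis
    by (simp add: algebra_simps)
qed

lemma cforms_scale: "F \<in> cforms n k \<Longrightarrow> (\<lambda>v. z * F v) \<in> cforms n k"
  using cforms_mult[OF cforms_const, of F n k z] by simp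

text \<open>When a linear form takes the value 1 on \<open>S\<close>, a polynomial of degree less than \<open>k\<close> agrees on
  \<open>S\<close> with a form of degree \<open>k - 1\<close>.\<close>

fun deg_less :: "nat \<Rightarrow> (nat \<Rightarrow> complex) set \<Rightarrow> nat \<Rightarrow> ((nat \<Rightarrow> complex) \<Rightarrow> complex) set" where
  "deg_less n S 0 = {F. \<forall>v\<in>S. F v = 0}"
| "deg_less n S (Suc k) = {F. \<exists>G\<in>cforms n k. \<forall>v\<in>S. F v = G v}"

lemma deg_less_cforms: "F \<in> cforms n k \<Longrightarrow> F \<in> deg_less n S (Suc k)"
  by auto

lemma deg_less_cong: "F \<in> deg_less n S k \<Longrightarrow> (\<And>v. v \<in> S \<Longrightarrow> F v = G v) \<Longrightarrow> G \<in> deg_less n S k"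
  by (cases k) auto

lemma deg_less_scale: "F \<in> deg_less n S k \<Longrightarrow> (\<lambda>v. z * F v) \<in> deg_less n S k"
  by (cases k) (auto dest: cforms_scale[where z = z])

lemma deg_less_add:
  "F \<in> deg_less n S k \<Longrightarrow> G \<in> deg_less n S k \<Longrightarrow> (\<lambda>v. F v + G v) \<in> deg_less n S k"
proof (cases k)
  case (Suc j)
  moreover assume "F \<in> deg_less n S k" "G \<in> deg_less n S k"
  ultimately obtain F' G' where "F' \<in> cforms n j" "G' \<in> cforms n j" "\<forall>v\<in>S. F v = F' v" "\<forall>v\<in>S. G v = G' v"
    by auto
  then show ?thesis
    using cforms_add[of F' n j G'] Suc by auto
qed auto

lemma deg_less_0: "(\<lambda>_. 0) \<in> deg_less n S k"
proof (cases k)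
  case (Suc j)
  have "(\<lambda>_. 0) \<in> cforms n j" using cforms_scale[OF cforms_peval[OF forms_0], of 0] by simp
  then show ?thesis unfolding Suc by (rule deg_less_cforms)
qed auto

lemma deg_less_sum:
  "(\<And>i. i \<in> I \<Longrightarrow> F i \<in> deg_less n S k) \<Longrightarrow> (\<lambda>v. \<Sum>i\<in>I. F i v) \<in> deg_less n S k"
  by (induction I rule: infinite_finite_induct) (auto simp: deg_less_0 intro!: deg_less_add)

text \<open>Index \<open>Suc j\<close> means agreement on \<open>S\<close> with a form of degree
  \<open>j\<close>, so degrees add while the offset by one is kept only once. For
  \<open>k = 0\<close> the product vanishes on \<open>S\<close>.\<close>

lemma deg_less_mult:
  assumes "F \<in> deg_less n S (Suc j)" "G \<in> deg_less n S k"
  shows "(\<lambda>v. F v * G v) \<in> deg_less n S (j + k)"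
proof -
  obtain F' where F': "F' \<in> cforms n j" "\<forall>v\<in>S. F v = F' v" using assms(1) by auto
  show ?thesis
  proof (cases "j + k")
    case 0
    then show ?thesis using assms(2) by auto
  next
    case (Suc i)
    show ?thesis
    proof (cases k)
      case 0
      then have "\<forall>v\<in>S. F v * G v = 0" using assms(2) by simp
      then show ?thesis by (intro deg_less_cong[OF deg_less_0]) auto
    next
      case k: (Suc k')
      obtain G' where "G' \<in> cforms n k'" "\<forall>v\<in>S. G v = G' v" using assms(2) k by auto
      then show ?thesis using cforms_mult[OF F'(1), of G' k'] F'(2) k by auto
    qed
  qed
qed

text \<open>Homogenisation: multiplying by the linear form with coefficients \<open>c\<close>
  changes nothing on \<open>S\<close>, where it equals 1, and raises the degree by one.\<close>

lemma deg_less_Suc: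
  assumes L: "\<And>v. v \<in> S \<Longrightarrow> (\<Sum>i<n. of_real (c i) * v i) = 1" and F: "F \<in> deg_less n S k"
  shows "F \<in> deg_less n S (Suc k)"
proof -
  define h :: rpoly where "h = (\<Sum>i<n. Poly_Mapping.single (Poly_Mapping.single i 1) (c i))"
  have "h \<in> forms n 1" unfolding h_def
    by (intro forms_sum single_forms mons_var) auto
  then have "(\<lambda>v. peval h v * F v) \<in> deg_less n S (1 + k)"
    by (intro deg_less_mult F deg_less_cforms cforms_peval)
  moreover have "\<forall>v\<in>S. peval h v = 1"
    using L by (simp add: h_def meval_single)
  ultimately show ?thesis by auto
qed

lemma deg_less_mono:
  assumes L: "\<And>v. v \<in> S \<Longrightarrow> (\<Sum>i<n. of_real (c i) * v i) = 1"
    and F: "F \<in> deg_less n S j" and "j \<le> k"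
  shows "F \<in> deg_less n S k"
  using \<open>j \<le> k\<close> F by (induction rule: dec_induct) (auto simp del: deg_less.simps intro: deg_less_Suc[OF L])

text \<open>The top degree part of a product is the product of the top degree parts. Here
  \<open>T i\<close> is the part of degree \<open>k\<close> and \<open>F i - T i\<close> the
  remainder of lower degree.\<close>

lemma deg_less_prod:
  assumes L: "\<And>v. v \<in> S \<Longrightarrow> (\<Sum>i<n. of_real (c i) * v i) = 1"
    and "finite I"
    and T: "\<And>i. i \<in> I \<Longrightarrow> T i \<in> deg_less n S (Suc k)"
    and R: "\<And>i. i \<in> I \<Longrightarrow> (\<lambda>v. F i v - T i v) \<in> deg_less n S k"
  shows "(\<lambda>v. \<Prod>i\<in>I. T i v) \<in> deg_less n S (Suc (card I * k)) \<and>
    (\<lambda>v. (\<Prod>i\<in>I. F i v) - (\<Prod>i\<in>I. T i v)) \<in> deg_less n S (card I * k)"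
  using \<open>finite I\<close> T R
proof (induction I rule: finite_induct)
  case empty
  have "(\<lambda>_. 1) \<in> deg_less n S (Suc 0)"
    by (rule deg_less_cforms[OF cforms_const])
  then show ?case by simp
next
  case (insert i I)
  let ?P = "\<lambda>v. \<Prod>i\<in>I. F i v" and ?Q = "\<lambda>v. \<Prod>i\<in>I. T i v"
  have Q: "?Q \<in> deg_less n S (Suc (card I * k))"
    and PQ: "(\<lambda>v. ?P v - ?Q v) \<in> deg_less n S (card I * k)"
    using insert by (auto simp del: deg_less.simps)
  have Ti: "T i \<in> deg_less n S (Suc k)" and Ri: "(\<lambda>v. F i v - T i v) \<in> deg_less n S k"
    using insert.prems by (auto simp del: deg_less.simps)
  have "(\<lambda>v. T i v + (F i v - T i v)) \<in> deg_less n S (Suc k)"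
    by (intro deg_less_add Ti deg_less_Suc[OF L] Ri)
  then have Fi: "F i \<in> deg_less n S (Suc k)" by simp
  have "(\<lambda>v. T i v * ?Q v) \<in> deg_less n S (k + Suc (card I * k))"
    by (rule deg_less_mult[OF Ti Q])
  \<comment> \<open>Telescoping: this equals \<open>F i v * ?P v - T i v * ?Q v\<close>, and each
    summand contains one factor of lower degree.\<close>
  moreover have "(\<lambda>v. F i v * (?P v - ?Q v) + ?Q v * (F i v - T i v)) \<in> deg_less n S (k + card I * k)"
    using deg_less_mult[OF Fi PQ] deg_less_mult[OF Q Ri] by (intro deg_less_add) (auto simp: add.commute)
  ultimately show ?case
    using insert.hyps by (simp del: deg_less.simps add: algebra_simps)
qed

text \<open>Continuity along complex lines suffices for all limits below and involves only functions
  of one complex variable.\<close>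

definition line_cont :: "((nat \<Rightarrow> complex) \<Rightarrow> complex) \<Rightarrow> bool" where
  "line_cont F \<longleftrightarrow> (\<forall>v w. isCont (\<lambda>t. F (\<lambda>i. v i + t * w i)) 0)"

lemma line_cont_meval: "line_cont (meval m)"
  unfolding line_cont_def meval_def by (intro allI continuous_intros)

lemma line_cont_peval: "line_cont (peval p)"
  unfolding line_cont_def peval_def by (intro allI continuous_intros)

text \<open>A Hadamard decomposition of the increment. The functions \<open>\<theta> j\<close> are
  not unique, but on the diagonal continuity forces them to be the partial derivatives.\<close>

definition diff_quotient ::
  "nat \<Rightarrow> rpoly \<Rightarrow> (nat \<Rightarrow> (nat \<Rightarrow> complex) \<Rightarrow> (nat \<Rightarrow> complex) \<Rightarrow> complex) \<Rightarrow> bool" where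
  "diff_quotient n p \<theta> \<longleftrightarrow>
     (\<forall>x y. peval p x - peval p y = (\<Sum>j<n. \<theta> j x y * (x j - y j))) \<and>
     (\<forall>j y. line_cont (\<lambda>x. \<theta> j x y))"

text \<open>Along the \<open>j\<close>-th coordinate only the \<open>j\<close>-th summand survives,
  so \<open>\<theta> j\<close> is the slope function in Caratheodory's criterion for
  differentiability.\<close>

lemma gradient_diff_quotient:
  assumes \<theta>: "diff_quotient n p \<theta>" and j: "j < n"
  shows "gradient p v j = \<theta> j v v"
proof -
  let ?e = "\<lambda>i. if i = j then 1 else 0 :: complex"
  have line: "v(j := z) = (\<lambda>i. v i + (z - v j) * ?e i)" for z by auto
  let ?g = "\<lambda>t. \<theta> j (\<lambda>i. v i + t * ?e i) v"
  have "isCont ?g (v j - v j)"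
    using \<theta> unfolding diff_quotient_def line_cont_def by simp
  then have "isCont (\<lambda>z. ?g (z - v j)) (v j)"
    by (rule isCont_o2[rotated]) simp
  then have cont: "isCont (\<lambda>z. \<theta> j (v(j := z)) v) (v j)" by (simp only: line)
  have "peval p (v(j := z)) - peval p (v(j := v j)) = \<theta> j (v(j := z)) v * (z - v j)" for z
  proof -
    have "peval p (v(j := z)) - peval p v = (\<Sum>i<n. \<theta> i (v(j := z)) v * ((v(j := z)) i - v i))"
      using \<theta> unfolding diff_quotient_def by blast
    also have "\<dots> = (\<Sum>i<n. if i = j then \<theta> j (v(j := z)) v * (z - v j) else 0)"
      by (rule sum.cong) auto
    finally show ?thesis using j by simp
  qed
  then have "((\<lambda>z. peval p (v(j := z))) has_field_derivative \<theta> j v v) (at (v j))"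
    unfolding CARAT_DERIV using cont by (intro exI[of _ "\<lambda>z. \<theta> j (v(j := z)) v"]) auto
  then show ?thesis unfolding gradient_def by (rule DERIV_imp_deriv)
qed

text \<open>\<open>T\<close> is the part of top degree in the first argument; it does not depend on the second
  one.\<close>

definition graded_quotient :: "nat \<Rightarrow> (nat \<Rightarrow> complex) set \<Rightarrow> nat \<Rightarrow> rpoly \<Rightarrow>
    (nat \<Rightarrow> (nat \<Rightarrow> complex) \<Rightarrow> (nat \<Rightarrow> complex) \<Rightarrow> complex) \<Rightarrow>
    (nat \<Rightarrow> (nat \<Rightarrow> complex) \<Rightarrow> complex) \<Rightarrow> bool" where
  "graded_quotient n S d p \<theta> T \<longleftrightarrow> diff_quotient n p \<theta> \<and>
     (\<forall>j. T j \<in> deg_less n S d) \<and>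
     (\<forall>j y. (\<lambda>x. \<theta> j x y) \<in> deg_less n S d) \<and>
     (\<forall>j y. (\<lambda>x. \<theta> j x y - T j x) \<in> deg_less n S (d - 1))"

text \<open>Induction on the degree through x_i m'(x) - y_i m'(y) = y_i (m'(x) - m'(y)) + m'(x) (x_i
  - y_i). The second summand supplies the top degree part, free of \<open>y\<close>; the quotient of
  the first has lower degree in \<open>x\<close>.\<close>

lemma graded_quotient_monomial:
  assumes L: "\<And>v. v \<in> S \<Longrightarrow> (\<Sum>i<n. of_real (c i) * v i) = 1" and "m \<in> mons n d"
  shows "\<exists>\<theta> T. graded_quotient n S d (Poly_Mapping.single m 1) \<theta> T"
  using \<open>m \<in> mons n d\<close>
proof (induction d arbitrary: m)
  case 0
  then have "m = 0"
    by (intro poly_mapping_eqI) (auto simp: mons_def in_keys_iff)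
  then show ?case
    by (intro exI[of _ "\<lambda>_ _ _. 0"] exI[of _ "\<lambda>_ _. 0"])
      (auto simp: graded_quotient_def diff_quotient_def line_cont_def)
next
  case (Suc d)
  obtain i m' where m': "i < n" "m' \<in> mons n d" "m = Poly_Mapping.single i 1 + m'"
    using mons_SucE[OF Suc.prems] .
  obtain \<theta>' T' where *: "graded_quotient n S d (Poly_Mapping.single m' 1) \<theta>' T'"
    using Suc.IH[OF m'(2)] by blast
  have ev: "meval m x = x i * meval m' x" for x :: "nat \<Rightarrow> complex"
    by (simp add: m'(3) meval_add meval_single)
  define T where "T = (\<lambda>j x. if j = i then meval m' x else (0::complex))"
  define \<theta> where "\<theta> = (\<lambda>j x y. y i * \<theta>' j x y + T j x)"
  have eq: "meval m x - meval m y = (\<Sum>j<n. \<theta> j x y * (x j - y j))" for x y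
  proof -
    have "(\<Sum>j<n. \<theta> j x y * (x j - y j)) =
      y i * (\<Sum>j<n. \<theta>' j x y * (x j - y j)) + (\<Sum>j<n. if j = i then meval m' x * (x i - y i) else 0)"
      unfolding sum_distrib_left sum.distrib[symmetric] \<theta>_def T_def
      by (rule sum.cong) (auto simp: algebra_simps)
    also have "(\<Sum>j<n. \<theta>' j x y * (x j - y j)) = meval m' x - meval m' y"
      using * unfolding graded_quotient_def diff_quotient_def by simp
    finally show ?thesis using m'(1) by (simp add: ev algebra_simps)
  qed
  have lc: "line_cont (\<lambda>x. \<theta> j x y)" for j y
  proof -
    have "line_cont (\<lambda>x. \<theta>' j x y)"
      using * unfolding graded_quotient_def diff_quotient_def by blast
    moreover have "line_cont (T j)"
      using line_cont_meval[of m'] unfolding T_def by (cases "j = i") (auto simp: line_cont_def)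
    ultimately show ?thesis
      unfolding \<theta>_def line_cont_def by (intro allI continuous_intros) auto
  qed
  have T: "T j \<in> deg_less n S (Suc d)" for j
  proof (cases "j = i")
    case True
    have "peval (Poly_Mapping.single m' 1) \<in> deg_less n S (Suc d)"
      by (intro deg_less_cforms cforms_peval single_forms m'(2))
    moreover have "peval (Poly_Mapping.single m' 1) = T j" using True by (auto simp: T_def)
    ultimately show ?thesis by simp
  next
    case False
    then have "T j = (\<lambda>_. 0)" by (auto simp: T_def)
    then show ?thesis using deg_less_0 by metis
  qed
  have R: "(\<lambda>x. y i * \<theta>' j x y) \<in> deg_less n S d" for j y
    using * unfolding graded_quotient_def by (intro deg_less_scale) blast
  have "(\<lambda>x. \<theta> j x y) \<in> deg_less n S (Suc d)" for j y
    unfolding \<theta>_def by (intro deg_less_add deg_less_Suc[OF L] R T)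
  then show ?case
    unfolding graded_quotient_def diff_quotient_def
    using eq lc T R by (intro exI[of _ \<theta>] exI[of _ T]) (auto simp del: deg_less.simps simp: \<theta>_def)
qed

lemma graded_quotient_exists:
  assumes L: "\<And>v. v \<in> S \<Longrightarrow> (\<Sum>i<n. of_real (c i) * v i) = 1" and p: "p \<in> forms n d"
  shows "\<exists>\<theta> T. graded_quotient n S d p \<theta> T"
  using p unfolding forms_eq_span
proof (induction rule: span_induct_alt)
  case base
  show ?case
    by (intro exI[of _ "\<lambda>_ _ _. 0"] exI[of _ "\<lambda>_ _. 0"])
      (auto simp: graded_quotient_def diff_quotient_def line_cont_def deg_less_0)
next
  case (step a p q)
  obtain \<theta>1 T1 where 1: "graded_quotient n S d p \<theta>1 T1"
    using graded_quotient_monomial[OF L] step.hyps by blast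
  obtain \<theta>2 T2 where 2: "graded_quotient n S d q \<theta>2 T2"
    using step.IH by blast
  define \<theta> where "\<theta> = (\<lambda>j x y. a * \<theta>1 j x y + \<theta>2 j x y)"
  define T where "T = (\<lambda>j x. a * T1 j x + T2 j x)"
  have "peval (a *\<^sub>R p + q) x - peval (a *\<^sub>R p + q) y = (\<Sum>j<n. \<theta> j x y * (x j - y j))" for x y
  proof -
    have "(\<Sum>j<n. \<theta> j x y * (x j - y j)) =
      a * (\<Sum>j<n. \<theta>1 j x y * (x j - y j)) + (\<Sum>j<n. \<theta>2 j x y * (x j - y j))"
      unfolding sum_distrib_left sum.distrib[symmetric] \<theta>_def
      by (rule sum.cong) (auto simp: algebra_simps)
    also have "\<dots> = a * (peval p x - peval p y) + (peval q x - peval q y)"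
      using 1 2 unfolding graded_quotient_def diff_quotient_def by simp
    finally show ?thesis by (simp add: algebra_simps)
  qed
  moreover have "line_cont (\<lambda>x. \<theta> j x y)" for j y
    using 1 2 unfolding graded_quotient_def diff_quotient_def line_cont_def \<theta>_def
    by (intro allI continuous_intros) auto
  moreover have "T j \<in> deg_less n S d" for j
    using 1 2 unfolding graded_quotient_def T_def by (intro deg_less_add deg_less_scale) auto
  moreover have "(\<lambda>x. \<theta> j x y) \<in> deg_less n S d" for j y
    using 1 2 unfolding graded_quotient_def \<theta>_def by (intro deg_less_add deg_less_scale) auto
  moreover have "(\<lambda>x. \<theta> j x y - T j x) \<in> deg_less n S (d - 1)" for j y
  proof -
    have "(\<lambda>x. a * (\<theta>1 j x y - T1 j x) + (\<theta>2 j x y - T2 j x)) \<in> deg_less n S (d - 1)"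
      using 1 2 unfolding graded_quotient_def by (intro deg_less_add deg_less_scale) auto
    then show ?thesis by (simp add: \<theta>_def T_def algebra_simps)
  qed
  ultimately show ?case
    unfolding graded_quotient_def diff_quotient_def by blast
qed

subsection \<open>The points of a transversal intersection\<close>

lemma homogeneous_system:
  fixes a :: "'i \<Rightarrow> 'j \<Rightarrow> 'a::field"
  assumes "finite I" "finite X" "card I < card X"
  shows "\<exists>x. (\<exists>j\<in>X. x j \<noteq> 0) \<and> (\<forall>i\<in>I. (\<Sum>j\<in>X. a i j * x j) = 0)"
  using assms
proof (induction I arbitrary: a X rule: finite_induct)
  case empty
  then have "X \<noteq> {}" by auto
  then show ?case by (intro exI[of _ "\<lambda>_. 1"]) auto
next
  case (insert i I)
  show ?case
  proof (cases "\<forall>j\<in>X. a i j = 0")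
    case True
    then show ?thesis using insert.IH[of X a] insert.prems insert.hyps by auto
  next
    case False
    then obtain j where j: "j \<in> X" "a i j \<noteq> 0" by blast
    let ?X = "X - {j}"
    have "card I < card ?X" using insert.prems insert.hyps j by simp
    then obtain x where x: "\<exists>k\<in>?X. x k \<noteq> 0"
      and eq: "\<forall>i'\<in>I. (\<Sum>k\<in>?X. (a i' k - a i' j * a i k / a i j) * x k) = 0"
      using insert.IH[of ?X "\<lambda>i' k. a i' k - a i' j * a i k / a i j"] insert.prems by auto
    \<comment> \<open>The pivot variable is solved from equation \<open>i\<close>; the other
      equations have been reduced by the same elimination.\<close>
    define y where "y = x(j := - (\<Sum>k\<in>?X. a i k * x k) / a i j)"
    have y: "(\<Sum>k\<in>X. b k * y k) = b j * y j + (\<Sum>k\<in>?X. b k * x k)" for b :: "'j \<Rightarrow> 'a"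
    proof -
      have "(\<Sum>k\<in>X. b k * y k) = b j * y j + (\<Sum>k\<in>?X. b k * y k)"
        using j insert.prems by (simp add: sum.remove)
      also have "(\<Sum>k\<in>?X. b k * y k) = (\<Sum>k\<in>?X. b k * x k)"
        by (rule sum.cong) (auto simp: y_def)
      finally show ?thesis .
    qed
    have "(\<Sum>k\<in>X. a i k * y k) = 0" using j by (simp add: y) (simp add: y_def)
    moreover have "(\<Sum>k\<in>X. a i' k * y k) = 0" if "i' \<in> I" for i'
    proof -
      have "(\<Sum>k\<in>?X. (a i' k - a i' j * a i k / a i j) * x k) =
          (\<Sum>k\<in>?X. a i' k * x k) + a i' j * y j"
        by (simp add: y_def left_diff_distrib sum_subtractf sum_distrib_left sum_divide_distrib mult.assoc)
      then show ?thesis using eq that by (simp add: y add.commute)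
    qed
    moreover have "\<exists>k\<in>X. y k \<noteq> 0" using x by (auto simp: y_def)
    ultimately show ?thesis by blast
  qed
qed

lemma independent_family:
  fixes v :: "'i \<Rightarrow> 'a::real_vector"
  assumes "finite I" and zero: "\<And>a. (\<Sum>i\<in>I. a i *\<^sub>R v i) = 0 \<Longrightarrow> \<forall>i\<in>I. a i = 0"
  shows "inj_on v I" "independent (v ` I)"
proof -
  show inj: "inj_on v I"
  proof (rule inj_onI, rule ccontr)
    fix i j assume ij: "i \<in> I" "j \<in> I" "v i = v j" "i \<noteq> j"
    \<comment> \<open>Two equal members would satisfy the relation with coefficients 1 and
      -1.\<close>
    let ?a = "\<lambda>k. (if k = i then 1 else 0) - (if k = j then 1 else 0) :: real"
    have "(\<Sum>k\<in>I. ?a k *\<^sub>R v k) =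
        (\<Sum>k\<in>I. if k = i then v i else 0) - (\<Sum>k\<in>I. if k = j then v j else 0)"
      unfolding sum_subtractf[symmetric] by (rule sum.cong) auto
    also have "\<dots> = 0" using ij \<open>finite I\<close> by simp
    finally have "(\<Sum>k\<in>I. ?a k *\<^sub>R v k) = 0" .
    from zero[OF this] show False using ij by force
  qed
  show "independent (v ` I)"
  proof (rule independent_if_scalars_zero)
    show "finite (v ` I)" using \<open>finite I\<close> by simp
  next
    fix a x assume "(\<Sum>x\<in>v ` I. a x *\<^sub>R x) = 0" "x \<in> v ` I"
    then show "a x = 0" using zero[of "\<lambda>i. a (v i)"] by (auto simp: sum.reindex[OF inj])
  qed
qed

lemma isCont_zero:
  fixes g :: "complex \<Rightarrow> complex"
  assumes "isCont g 0" "\<And>t. t \<noteq> 0 \<Longrightarrow> g t = 0"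
  shows "g 0 = 0"
proof -
  have "((\<lambda>_. 0) \<longlongrightarrow> g 0) (at (0::complex))"
    using assms(1) unfolding isCont_def
    by (rule Lim_transform_eventually) (use assms(2) in \<open>auto simp: eventually_at_filter\<close>)
  from LIM_const_eq[OF this] show ?thesis by simp
qed

text \<open>The increment along the line \<open>v + t w\<close>, already divided by \<open>t\<close>
  and hence meaningful at \<open>t = 0\<close>, where it is the directional derivative.\<close>

definition slope :: "nat \<Rightarrow> (nat \<Rightarrow> (nat \<Rightarrow> complex) \<Rightarrow> (nat \<Rightarrow> complex) \<Rightarrow> complex) \<Rightarrow>
    (nat \<Rightarrow> complex) \<Rightarrow> (nat \<Rightarrow> complex) \<Rightarrow> complex \<Rightarrow> complex" where
  "slope n \<theta> v w t = (\<Sum>j<n. \<theta> j (\<lambda>i. v i + t * w i) v * w j)"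

lemma slope:
  assumes "diff_quotient n p \<theta>"
  shows "peval p (\<lambda>i. v i + t * w i) = peval p v + t * slope n \<theta> v w t"
    and "isCont (slope n \<theta> v w) 0"
    and "slope n \<theta> v w 0 = (\<Sum>j<n. gradient p v j * w j)"
proof -
  have "peval p (\<lambda>i. v i + t * w i) - peval p v
      = (\<Sum>j<n. \<theta> j (\<lambda>i. v i + t * w i) v * (v j + t * w j - v j))"
    using assms unfolding diff_quotient_def by blast
  also have "\<dots> = t * slope n \<theta> v w t"
    by (simp add: slope_def sum_distrib_left mult_ac)
  finally show "peval p (\<lambda>i. v i + t * w i) = peval p v + t * slope n \<theta> v w t"
    by (simp add: algebra_simps)
  show "isCont (slope n \<theta> v w) 0"
    using assms unfolding slope_def[abs_def] diff_quotient_def line_cont_def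
    by (intro continuous_intros) auto
  show "slope n \<theta> v w 0 = (\<Sum>j<n. gradient p v j * w j)"
    by (simp add: slope_def gradient_diff_quotient[OF assms])
qed

lemma diff_quotient_exists:
  assumes "p \<in> forms n d"
  shows "\<exists>\<theta>. diff_quotient n p \<theta>"
  \<comment> \<open>With \<open>S = {}\<close> the normalisation hypothesis is vacuous.\<close>
  using graded_quotient_exists[where S = "{}" and n = n and p = p and d = d] assms unfolding graded_quotient_def by blast

text \<open>Euler's relation at a zero: \<open>p\<close> vanishes on the whole line through 0 and
  \<open>v\<close>, so its derivative in direction \<open>v\<close> is 0.\<close>

lemma euler_zero:
  assumes "p \<in> forms n d" "peval p v = 0"
  shows "(\<Sum>j<n. gradient p v j * v j) = 0"
proof -
  obtain \<theta> where \<theta>: "diff_quotient n p \<theta>" using diff_quotient_exists[OF assms(1)] by blast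
  have "slope n \<theta> v v t = 0" if "t \<noteq> 0" for t
  proof -
    have "peval p (\<lambda>i. v i + t * v i) = peval p (\<lambda>i. (1 + t) * v i)" by (simp add: algebra_simps)
    also have "\<dots> = 0" using peval_scale[OF assms(1), of "1 + t" v] assms(2) by simp
    finally show ?thesis using slope(1)[OF \<theta>, of v t v] assms(2) that by simp
  qed
  from isCont_zero[OF slope(2)[OF \<theta>] this] show ?thesis by (simp add: slope(3)[OF \<theta>])
qed

section \<open>Linear relations between point evaluations\<close>

definition annihilates :: "nat \<Rightarrow> nat \<Rightarrow> (nat \<Rightarrow> complex) set \<Rightarrow> ((nat \<Rightarrow> complex) \<Rightarrow> complex) \<Rightarrow> bool" where
  "annihilates n k S w \<longleftrightarrow> (\<forall>p\<in>forms n k. (\<Sum>v\<in>S. w v * peval p v) = 0)"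

lemma annihilates_deg_less:
  assumes "annihilates n k S w" "F \<in> deg_less n S (Suc k)"
  shows "(\<Sum>v\<in>S. w v * F v) = 0"
proof -
  obtain a b where ab: "a \<in> forms n k" "b \<in> forms n k" "\<forall>v\<in>S. F v = peval a v + \<i> * peval b v"
    using assms(2) by (auto simp: cforms_def)
  then have "(\<Sum>v\<in>S. w v * F v) = (\<Sum>v\<in>S. w v * peval a v) + \<i> * (\<Sum>v\<in>S. w v * peval b v)"
    unfolding sum_distrib_left sum.distrib[symmetric] by (intro sum.cong) (auto simp: algebra_simps)
  then show ?thesis using assms(1) ab unfolding annihilates_def by simp
qed

lemma forms_basis_card:
  assumes "independent B" "B \<subseteq> forms n k" "forms n k \<subseteq> span B"
  shows "finite B" "card B = dim (forms n k)"
proof -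
  show "finite B"
    using independent_span_bound[of "monomials n k" B] assms(1,2) mons_card(1) by (auto simp: forms_eq_span)
  show "card B = dim (forms n k)" by (rule basis_card_eq_dim[OF assms(2,3,1)])
qed

text \<open>The unknowns are the weights outside \<open>T\<close>. The forms in \<open>C\<close>
  vanish on \<open>S\<close> and impose no condition, so only
  \<open>dim (forms n k) - card C\<close> equations remain.\<close>

lemma annihilator_exists:
  assumes "finite S" "T \<subseteq> S" and C: "C \<subseteq> forms n k" "independent C"
    and C0: "\<And>p v. p \<in> C \<Longrightarrow> v \<in> S \<Longrightarrow> peval p v = 0"
    and card: "dim (forms n k) + card T < card S + card C"
  shows "\<exists>w. annihilates n k S w \<and> (\<forall>v\<in>T. w v = 0) \<and> (\<exists>v\<in>S. w v \<noteq> 0)"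
proof -
  obtain B where B: "C \<subseteq> B" "B \<subseteq> forms n k" "independent B" "forms n k \<subseteq> span B"
    using maximal_independent_subset_extend[OF C] .
  note fin = forms_basis_card[OF B(3,2,4)]
  have fC: "finite C" using B fin finite_subset by blast
  have "card (B - C) < card (S - T)"
    using card B fin fC assms(1,2) finite_subset[OF assms(2,1)] card_mono[OF fin(1) B(1)]
    by (simp add: card_Diff_subset)
  then obtain x where x: "\<exists>v\<in>S - T. x v \<noteq> 0" "\<forall>p\<in>B - C. (\<Sum>v\<in>S - T. peval p v * x v) = 0"
    using homogeneous_system[of "B - C" "S - T" peval] fin assms(1) by auto
  define w where "w = (\<lambda>v. if v \<in> T then 0 else x v)"
  have "(\<Sum>v\<in>S. w v * peval p v) = 0" if "p \<in> B" for p
  proof (cases "p \<in> C")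
    case False
    have "(\<Sum>v\<in>S. w v * peval p v) = (\<Sum>v\<in>S - T. peval p v * x v)"
      using assms(1) by (intro sum.mono_neutral_cong_right) (auto simp: w_def)
    then show ?thesis using x that False by auto
  qed (simp add: C0)
  note w_B = this
  have "(\<Sum>v\<in>S. w v * peval p v) = 0" if "p \<in> span B" for p
    using that
  proof (induction rule: span_induct_alt)
    case (step a p q)
    have "(\<Sum>v\<in>S. w v * peval (a *\<^sub>R p + q) v) =
        of_real a * (\<Sum>v\<in>S. w v * peval p v) + (\<Sum>v\<in>S. w v * peval q v)"
      unfolding sum_distrib_left sum.distrib[symmetric] by (intro sum.cong) (auto simp: algebra_simps)
    then show ?case using step w_B by simp
  qed simp
  then have "annihilates n k S w" using B unfolding annihilates_def by blast
  moreover have "\<exists>v\<in>S. w v \<noteq> 0" using x by (auto simp: w_def)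
  ultimately show ?thesis by (auto simp: w_def)
qed

text \<open>The two cases of the theorem enter only through the last three assumptions:
  \<open>degree\<close> gives the Bezoutian degree \<open>d + 1\<close>, \<open>dim_d\<close> leaves
  room for a relation on \<open>S\<close> in degree \<open>d\<close>, and \<open>dim_2d\<close>
  matches the count of products in \<open>noether\<close>.\<close>

locale transversal_points =
  fixes n d :: nat and f :: "nat \<Rightarrow> rpoly" and c :: "nat \<Rightarrow> real" and S :: "(nat \<Rightarrow> complex) set"
  assumes forms: "\<And>j. j \<in> {1..n - 1} \<Longrightarrow> f j \<in> forms n d"
    and finite_S: "finite S"
    and nonempty: "S \<noteq> {}"
    and tail: "\<And>v i. v \<in> S \<Longrightarrow> i \<ge> n \<Longrightarrow> v i = 0"
    and slice: "\<And>v. v \<in> S \<Longrightarrow> (\<Sum>i<n. of_real (c i) * v i) = 1"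
    and zero: "\<And>v j. v \<in> S \<Longrightarrow> j \<in> {1..n - 1} \<Longrightarrow> peval (f j) v = 0"
    and transversal: "\<And>v. v \<in> S \<Longrightarrow> gradients_independent n f v"
    and degree: "(n - 1) * (d - 1) = d + 1"
    and dim_d: "dim (forms n d) + 2 = card S + n"
    and dim_2d: "dim (forms n (2 * d)) = (n - 1) * (card S - 1) + n * (n - 1) div 2 + card S"
begin

lemma transversalD:
  assumes "v \<in> S" "\<And>i. i < n \<Longrightarrow> (\<Sum>j\<in>{1..n - 1}. a j * gradient (f j) v i) = 0" "j \<in> {1..n - 1}"
  shows "a j = 0"
  using transversal[OF assms(1)] assms(2,3) unfolding gradients_independent_def by blast

lemma n_d_bounds: "n \<ge> 2" "d \<ge> 2"
proof -
  have "n - 1 \<noteq> 0" "d - 1 \<noteq> 0" using degree by (auto intro!: Nat.gr0I)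
  then show "n \<ge> 2" "d \<ge> 2" by auto
qed

text \<open>For distinct points the kernel of the bordered matrix contains \<open>p - q\<close>. On
  the diagonal its rows are the gradients and \<open>c\<close>, which are independent because the
  gradients kill \<open>p\<close> by Euler while \<open>c\<close> gives 1 there. The degree is
  \<open>(n - 1) * (d - 1) = d + 1\<close>, and the index of \<open>deg_less\<close> is one
  more.\<close>

lemma bezoutian:
  obtains D T where "\<And>p q. p \<in> S \<Longrightarrow> q \<in> S \<Longrightarrow> p \<noteq> q \<Longrightarrow> D p q = 0"
    "\<And>p. p \<in> S \<Longrightarrow> D p p \<noteq> 0"
    "T \<in> deg_less n S (d + 2)" "\<And>q. (\<lambda>x. D x q - T x) \<in> deg_less n S (d + 1)"
proof -
  obtain m where n: "n = Suc m" using n_d_bounds by (cases n) auto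
  have "\<exists>\<theta> T. graded_quotient n S d (f (Suc i)) \<theta> T" if "i < m" for i
    using graded_quotient_exists[OF slice, where p = "f (Suc i)" and d = d] forms[of "Suc i"] that n by auto
  then obtain \<theta> T where \<theta>: "\<And>i. i < m \<Longrightarrow> graded_quotient n S d (f (Suc i)) (\<theta> i) (T i)"
    by metis
  then have dq: "diff_quotient n (f (Suc i)) (\<theta> i)" if "i < m" for i
    using that unfolding graded_quotient_def by blast
  \<comment> \<open>Row \<open>i < m\<close> belongs to \<open>f (Suc i)\<close>, as the forms are
    numbered from 1; the last row is \<open>c\<close>.\<close>
  define A where "A = (\<lambda>x y. mat n n (\<lambda>(i, j). if i = m then of_real (c j) else \<theta> i j x y))"
  define D where "D = (\<lambda>x y. det (A x y))"
  have A: "A x y \<in> carrier_mat n n" for x y by (simp add: A_def)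
  have Aij: "A x y $$ (i, j) = (if i = m then of_real (c j) else \<theta> i j x y)"
    if "i < n" "j < n" for x y i j using that by (simp add: A_def)
  have "D p q = 0" if p: "p \<in> S" and q: "q \<in> S" and "p \<noteq> q" for p q
  proof -
    define v where "v = vec n (\<lambda>j. p j - q j)"
    obtain k where "p k \<noteq> q k" using \<open>p \<noteq> q\<close> by auto
    then have "k < n" using tail p q by (metis not_less)
    then have "v $ k \<noteq> 0\<^sub>v n $ k" using \<open>p k \<noteq> q k\<close> by (simp add: v_def)
    then have "v \<noteq> 0\<^sub>v n" by auto
    moreover have "A p q *\<^sub>v v = 0\<^sub>v n"
    proof (rule eq_vecI)
      fix i assume "i < dim_vec (0\<^sub>v n :: complex vec)"
      then have i: "i < n" by simp
      have "(A p q *\<^sub>v v) $ i = (\<Sum>j<n. A p q $$ (i, j) * (p j - q j))"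
        using i A[of p q] by (simp add: scalar_prod_def v_def atLeast0LessThan)
      also have "\<dots> = 0"
      proof (cases "i = m")
        case True
        then have "(\<Sum>j<n. A p q $$ (i, j) * (p j - q j)) =
          (\<Sum>j<n. of_real (c j) * p j) - (\<Sum>j<n. of_real (c j) * q j)"
          using i unfolding sum_subtractf[symmetric] by (intro sum.cong) (auto simp: Aij algebra_simps)
        then show ?thesis by (simp add: slice p q)
      next
        case False
        then have im: "i < m" using i n by simp
        have "(\<Sum>j<n. A p q $$ (i, j) * (p j - q j)) = (\<Sum>j<n. \<theta> i j p q * (p j - q j))"
          using i False by (intro sum.cong) (auto simp: Aij)
        also have "\<dots> = peval (f (Suc i)) p - peval (f (Suc i)) q"
          using dq[OF im] unfolding diff_quotient_def by simp
        finally show ?thesis using zero p q im n by simp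
      qed
      finally show "(A p q *\<^sub>v v) $ i = 0\<^sub>v n $ i" using i by simp
    qed (use A[of p q] in simp)
    ultimately show ?thesis
      unfolding D_def det_0_iff_vec_prod_zero[OF A] by (intro exI[of _ v]) (auto simp: v_def)
  qed
  moreover have "D p p \<noteq> 0" if p: "p \<in> S" for p
  proof
    assume "D p p = 0"
    then have "det (transpose_mat (A p p)) = 0" by (simp add: D_def det_transpose[OF A])
    then obtain u where u: "u \<in> carrier_vec n" "u \<noteq> 0\<^sub>v n" "transpose_mat (A p p) *\<^sub>v u = 0\<^sub>v n"
      using det_0_iff_vec_prod_zero[of "transpose_mat (A p p)" n] A by auto
    have row: "(\<Sum>i<n. u $ i * A p p $$ (i, j)) = 0" if j: "j < n" for j
    proof -
      have "(\<Sum>i<n. u $ i * A p p $$ (i, j)) = (transpose_mat (A p p) *\<^sub>v u) $ j"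
        using j u(1) A[of p p] by (simp add: scalar_prod_def atLeast0LessThan mult.commute)
      then show ?thesis using u(3) j by simp
    qed
    have row': "(\<Sum>i<m. u $ i * gradient (f (Suc i)) p j) + u $ m * of_real (c j) = 0" if j: "j < n" for j
    proof -
      have "(\<Sum>i<m. u $ i * A p p $$ (i, j)) = (\<Sum>i<m. u $ i * gradient (f (Suc i)) p j)"
        using j n by (intro sum.cong) (auto simp: Aij gradient_diff_quotient[OF dq])
      then show ?thesis using row[OF j] j n by (simp add: Aij)
    qed
    \<comment> \<open>Pairing the row relation with \<open>p\<close> itself isolates the coefficient
      of \<open>c\<close>.\<close>
    have "0 = (\<Sum>j<n. p j * ((\<Sum>i<m. u $ i * gradient (f (Suc i)) p j) + u $ m * of_real (c j)))"
      using row' by simp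
    also have "\<dots> = (\<Sum>i<m. u $ i * (\<Sum>j<n. gradient (f (Suc i)) p j * p j)) + u $ m * (\<Sum>j<n. of_real (c j) * p j)"
      by (simp add: distrib_left sum.distrib sum_distrib_left sum.swap[of _ "{..<m}"] mult_ac)
    also have "\<dots> = u $ m"
    proof -
      have "(\<Sum>j<n. gradient (f (Suc i)) p j * p j) = 0" if "i < m" for i
        using that n by (intro euler_zero[OF forms zero[OF p]]) auto
      then have "(\<Sum>i<m. u $ i * (\<Sum>j<n. gradient (f (Suc i)) p j * p j)) = 0"
        by simp
      then show ?thesis by (simp only: slice[OF p]) simp
    qed
    finally have um: "u $ m = 0" by simp
    have "u $ i = 0" if "i < m" for i
    proof -
      have "(\<Sum>j\<in>{1..n - 1}. u $ (j - 1) * gradient (f j) p k) = 0" if "k < n" for k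
      proof -
        have "(\<Sum>j\<in>{1..n - 1}. u $ (j - 1) * gradient (f j) p k) = (\<Sum>i<m. u $ i * gradient (f (Suc i)) p k)"
          by (rule sum.reindex_bij_witness[of _ Suc "\<lambda>j. j - 1"]) (auto simp: n)
        then show ?thesis using row'[OF that] um by simp
      qed
      from transversalD[OF p this, of "Suc i"] show ?thesis using that n by simp
    qed
    then have "u = 0\<^sub>v n" using um u(1) n by (intro eq_vecI) (auto simp: less_Suc_eq)
    with u(2) show False by simp
  qed
  moreover
  \<comment> \<open>The top degree part of \<open>D\<close>: the Leibniz expansion with each
    \<open>\<theta>\<close> replaced by its leading part, row \<open>m\<close> contributing
    constants.\<close>
  define TT where "TT = (\<lambda>x. \<Sum>\<pi>\<in>{\<pi>. \<pi> permutes {0..<n}}.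
    (signof \<pi> * of_real (c (\<pi> m))) * (\<Prod>i\<in>{..<m}. T i (\<pi> i) x))"
  have D: "D x y = (\<Sum>\<pi>\<in>{\<pi>. \<pi> permutes {0..<n}}.
    (signof \<pi> * of_real (c (\<pi> m))) * (\<Prod>i\<in>{..<m}. \<theta> i (\<pi> i) x y))" for x y
    unfolding D_def det_def'[OF A]
  proof (rule sum.cong[OF refl])
    fix \<pi> assume "\<pi> \<in> {\<pi>. \<pi> permutes {0..<n}}"
    then have lt: "\<pi> i < n" if "i < n" for i using that permutes_in_image[of \<pi> "{0..<n}" i] by auto
    have "(\<Prod>i = 0..<n. A x y $$ (i, \<pi> i)) = (\<Prod>i<m. A x y $$ (i, \<pi> i)) * of_real (c (\<pi> m))"
      using lt n by (simp add: atLeast0LessThan Aij)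
    also have "(\<Prod>i<m. A x y $$ (i, \<pi> i)) = (\<Prod>i<m. \<theta> i (\<pi> i) x y)"
      using lt n by (intro prod.cong) (auto simp: Aij)
    finally show "signof \<pi> * (\<Prod>i = 0..<n. A x y $$ (i, \<pi> i)) =
      signof \<pi> * of_real (c (\<pi> m)) * (\<Prod>i<m. \<theta> i (\<pi> i) x y)" by simp
  qed
  have d: "d = Suc (d - 1)" using n_d_bounds by simp
  have md: "m * (d - 1) = d + 1" using degree n by simp
  have "(\<lambda>x. \<Prod>i\<in>{..<m}. T i (\<pi> i) x) \<in> deg_less n S (Suc (card {..<m} * (d - 1))) \<and>
    (\<lambda>x. (\<Prod>i\<in>{..<m}. \<theta> i (\<pi> i) x q) - (\<Prod>i\<in>{..<m}. T i (\<pi> i) x)) \<in> deg_less n S (card {..<m} * (d - 1))"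
    for \<pi> q
    using \<theta> d unfolding graded_quotient_def by (intro deg_less_prod[OF slice]) auto
  then have prods: "(\<lambda>x. \<Prod>i\<in>{..<m}. T i (\<pi> i) x) \<in> deg_less n S (d + 2)"
    "(\<lambda>x. (\<Prod>i\<in>{..<m}. \<theta> i (\<pi> i) x q) - (\<Prod>i\<in>{..<m}. T i (\<pi> i) x)) \<in> deg_less n S (d + 1)" for \<pi> q
    unfolding card_lessThan md by (simp_all del: deg_less.simps)
  have "TT \<in> deg_less n S (d + 2)"
    unfolding TT_def by (intro deg_less_sum deg_less_scale prods)
  moreover have "(\<lambda>x. D x q - TT x) \<in> deg_less n S (d + 1)" for q
    unfolding D TT_def sum_subtractf[symmetric] right_diff_distrib[symmetric]
    by (intro deg_less_sum deg_less_scale prods)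
  ultimately show thesis by (rule that)
qed

section \<open>Differentials at the points and syzygies\<close>

lemma slopes_exist:
  obtains A where
    "\<And>j v w t. j \<in> {1..n - 1} \<Longrightarrow> peval (f j) (\<lambda>i. v i + t * w i) = peval (f j) v + t * A j v w t"
    "\<And>j v w. j \<in> {1..n - 1} \<Longrightarrow> isCont (A j v w) 0"
    "\<And>j v w. j \<in> {1..n - 1} \<Longrightarrow> A j v w 0 = (\<Sum>i<n. gradient (f j) v i * w i)"
proof -
  obtain \<theta> where \<theta>: "\<And>j. j \<in> {1..n - 1} \<Longrightarrow> diff_quotient n (f j) (\<theta> j)"
    using diff_quotient_exists[OF forms] by metis
  from slope[OF \<theta>] show thesis by (intro that[of "\<lambda>j. slope n (\<theta> j)"])
qed

lemma transversal_combination: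
  assumes p: "p \<in> S" and "\<And>w. (\<Sum>j\<in>{1..n - 1}. a j * (\<Sum>i<n. gradient (f j) p i * w i)) = 0"
    and j: "j \<in> {1..n - 1}"
  shows "a j = 0"
proof (rule transversalD[OF p _ j])
  fix k assume k: "k < n"
  have "(\<Sum>i<n. gradient (f j) p i * (if i = k then 1 else 0)) = gradient (f j) p k" for j
  proof -
    have "(\<Sum>i<n. gradient (f j) p i * (if i = k then 1 else 0)) = (\<Sum>i<n. if i = k then gradient (f j) p k else 0)"
      by (rule sum.cong) auto
    then show ?thesis using k by simp
  qed
  then show "(\<Sum>j\<in>{1..n - 1}. a j * gradient (f j) p k) = 0"
    using assms(2)[of "\<lambda>i. if i = k then 1 else 0"] by simp
qed

text \<open>Along \<open>p + t w\<close> each \<open>f j\<close> is divisible by \<open>t\<close>.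
  Dividing the syzygy by \<open>t\<close> and letting \<open>t\<close> tend to 0 leaves a relation
  between the differentials at \<open>p\<close>, trivial by transversality.\<close>

lemma syzygy_vanishes:
  assumes p: "p \<in> S" and a: "\<And>j. j \<in> {1..n - 1} \<Longrightarrow> line_cont (a j)"
    and syz: "\<And>x. (\<Sum>j\<in>{1..n - 1}. a j x * peval (f j) x) = 0" and j: "j \<in> {1..n - 1}"
  shows "a j p = 0"
proof (rule transversal_combination[OF p _ j, of "\<lambda>j. a j p"])
  fix w
  obtain A where A: "\<And>j v w t. j \<in> {1..n - 1} \<Longrightarrow> peval (f j) (\<lambda>i. v i + t * w i) = peval (f j) v + t * A j v w t"
    "\<And>j v w. j \<in> {1..n - 1} \<Longrightarrow> isCont (A j v w) 0"
    "\<And>j v w. j \<in> {1..n - 1} \<Longrightarrow> A j v w 0 = (\<Sum>i<n. gradient (f j) v i * w i)"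
    by (rule slopes_exist) blast
  let ?g = "\<lambda>t. \<Sum>j\<in>{1..n - 1}. a j (\<lambda>i. p i + t * w i) * A j p w t"
  have "isCont ?g 0"
    using a A(2) unfolding line_cont_def by (intro continuous_intros) auto
  moreover have "?g t = 0" if "t \<noteq> 0" for t
  proof -
    have "t * ?g t = (\<Sum>j\<in>{1..n - 1}. a j (\<lambda>i. p i + t * w i) * peval (f j) (\<lambda>i. p i + t * w i))"
      unfolding sum_distrib_left by (rule sum.cong) (auto simp: A(1) zero[OF p])
    then show ?thesis using syz that by simp
  qed
  ultimately have "?g 0 = 0" by (rule isCont_zero)
  then show "(\<Sum>j\<in>{1..n - 1}. a j p * (\<Sum>i<n. gradient (f j) p i * w i)) = 0"
    by (simp add: A(3))
qed

text \<open>A linear relation is a syzygy with constant coefficients.\<close>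

lemma independent_f: "inj_on f {1..n - 1}" "independent (f ` {1..n - 1})"
proof -
  obtain p where p: "p \<in> S" using nonempty by blast
  have "\<forall>j\<in>{1..n - 1}. a j = 0" if eq: "(\<Sum>j\<in>{1..n - 1}. a j *\<^sub>R f j) = 0" for a
  proof
    fix j assume j: "j \<in> {1..n - 1}"
    have "(\<Sum>j\<in>{1..n - 1}. of_real (a j) * peval (f j) x) = (0 :: complex)" for x
      using arg_cong[OF eq, of "\<lambda>q. peval q x"] by simp
    from syzygy_vanishes[OF p _ this j] show "a j = 0" by (simp add: line_cont_def)
  qed
  from independent_family[OF _ this] show "inj_on f {1..n - 1}" "independent (f ` {1..n - 1})" by auto
qed

lemma card_f: "card (f ` {1..n - 1}) = n - 1"
  using card_image[OF independent_f(1)] by simp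

text \<open>At a point of \<open>S\<close> the second order part of a quadratic relation is a relation between the
  differentials, which are linearly independent.\<close>

lemma quadratic_relation_skew:
  assumes rel: "\<And>x. (\<Sum>j\<in>{1..n - 1}. \<Sum>k\<in>{1..n - 1}. m j k * (peval (f j) x * peval (f k) x)) = (0 :: complex)"
    and j: "j \<in> {1..n - 1}" and k: "k \<in> {1..n - 1}"
  shows "m j k + m k j = 0"
proof -
  let ?J = "{1..n - 1}"
  obtain p where p: "p \<in> S" using nonempty by blast
  obtain A where A: "\<And>j v w t. j \<in> ?J \<Longrightarrow> peval (f j) (\<lambda>i. v i + t * w i) = peval (f j) v + t * A j v w t"
    "\<And>j v w. j \<in> ?J \<Longrightarrow> isCont (A j v w) 0"
    "\<And>j v w. j \<in> ?J \<Longrightarrow> A j v w 0 = (\<Sum>i<n. gradient (f j) v i * w i)"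
    by (rule slopes_exist) blast
  define D where "D = (\<lambda>j w. \<Sum>i<n. gradient (f j) p i * w i)"
  have D_add: "D j (\<lambda>i. w i + w' i) = D j w + D j w'" for j w w'
    by (simp add: D_def distrib_left sum.distrib)
  have quad: "(\<Sum>j\<in>?J. \<Sum>k\<in>?J. m j k * (D j w * D k w)) = 0" for w
  proof -
    let ?g = "\<lambda>t. \<Sum>j\<in>?J. \<Sum>k\<in>?J. m j k * (A j p w t * A k p w t)"
    have "isCont ?g 0" using A(2) by (intro continuous_intros) auto
    moreover have "?g t = 0" if "t \<noteq> 0" for t
    proof -
      let ?x = "\<lambda>i. p i + t * w i"
      have "t * t * ?g t = (\<Sum>j\<in>?J. \<Sum>k\<in>?J. m j k * (peval (f j) ?x * peval (f k) ?x))"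
        unfolding sum_distrib_left by (intro sum.cong refl) (auto simp: A(1) zero[OF p])
      then show ?thesis using rel that by simp
    qed
    ultimately have "?g 0 = 0" by (rule isCont_zero)
    then show ?thesis by (simp add: A(3) D_def)
  qed
  \<comment> \<open>Polarisation: a vanishing quadratic form gives information only on the
    symmetrised coefficients.\<close>
  have polar: "(\<Sum>j\<in>?J. (\<Sum>k\<in>?J. (m j k + m k j) * D k w') * D j w) = 0" for w w'
  proof -
    have "(\<Sum>j\<in>?J. (\<Sum>k\<in>?J. (m j k + m k j) * D k w') * D j w) =
        (\<Sum>j\<in>?J. \<Sum>k\<in>?J. m j k * (D j w * D k w')) + (\<Sum>j\<in>?J. \<Sum>k\<in>?J. m k j * (D k w' * D j w))"
      unfolding sum_distrib_right sum.distrib[symmetric] by (intro sum.cong refl) (simp add: algebra_simps)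
    also have "(\<Sum>j\<in>?J. \<Sum>k\<in>?J. m k j * (D k w' * D j w)) = (\<Sum>j\<in>?J. \<Sum>k\<in>?J. m j k * (D j w' * D k w))"
      by (rule sum.swap)
    also have "(\<Sum>j\<in>?J. \<Sum>k\<in>?J. m j k * (D j w * D k w')) + \<dots> =
        (\<Sum>j\<in>?J. \<Sum>k\<in>?J. m j k * (D j (\<lambda>i. w i + w' i) * D k (\<lambda>i. w i + w' i)))
        - (\<Sum>j\<in>?J. \<Sum>k\<in>?J. m j k * (D j w * D k w)) - (\<Sum>j\<in>?J. \<Sum>k\<in>?J. m j k * (D j w' * D k w'))"
      unfolding sum.distrib[symmetric] sum_subtractf[symmetric]
      by (intro sum.cong refl) (simp add: D_add algebra_simps)
    finally show ?thesis by (simp only: quad) simp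
  qed
  \<comment> \<open>Transversality is applied twice, first in the index \<open>j\<close> and then in
    \<open>k\<close>.\<close>
  have "(\<Sum>k\<in>?J. (m j k + m k j) * D k w') = 0" for w'
    using polar unfolding D_def
    by (rule transversal_combination[OF p _ j, of "\<lambda>j. \<Sum>k\<in>?J. (m j k + m k j) * (\<Sum>i<n. gradient (f k) p i * w' i)"])
  then show ?thesis unfolding D_def
    by (rule transversal_combination[OF p _ k, of "\<lambda>k. m j k + m k j"])
qed

text \<open>Pairing an annihilating \<open>w\<close> with \<open>D\<close> in the first argument
  leaves \<open>w q * D q q\<close>. Replacing \<open>D\<close> by \<open>T\<close> does not change
  the sum, since the difference agrees on \<open>S\<close> with a form of degree \<open>d\<close>;
  so this number does not depend on \<open>q\<close>. Interpolation uses combinations of the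
  functions \<open>D p q\<close> of \<open>p\<close>.\<close>

lemma cayley_bacharach:
  obtains u where "\<And>p. p \<in> S \<Longrightarrow> u p \<noteq> 0" "annihilates n d S u"
    "\<And>w. annihilates n d S w \<Longrightarrow> \<exists>k. \<forall>p\<in>S. w p = k * u p"
    "\<And>x. (\<Sum>p\<in>S. u p * x p) = 0 \<Longrightarrow> x \<in> deg_less n S (Suc d)"
    "\<And>x. x \<in> deg_less n S (Suc (2 * d))"
proof -
  obtain D T where off: "\<And>p q. p \<in> S \<Longrightarrow> q \<in> S \<Longrightarrow> p \<noteq> q \<Longrightarrow> D p q = 0"
    and diag: "\<And>p. p \<in> S \<Longrightarrow> D p p \<noteq> 0"
    and T: "T \<in> deg_less n S (d + 2)" and R: "\<And>q. (\<lambda>x. D x q - T x) \<in> deg_less n S (d + 1)"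
    by (rule bezoutian) blast
  have sum_D: "(\<Sum>q\<in>S. x q * D p q) = x p * D p p" if "p \<in> S" for p x
  proof -
    have "(\<Sum>q\<in>S. x q * D p q) = (\<Sum>q\<in>S. if q = p then x p * D p p else 0)"
      using that by (intro sum.cong) (auto simp: off)
    then show ?thesis using that finite_S by simp
  qed
  have sum_D': "(\<Sum>p\<in>S. w p * D p q) = w q * D q q" if "q \<in> S" for q w
  proof -
    have "(\<Sum>p\<in>S. w p * D p q) = (\<Sum>p\<in>S. if p = q then w q * D q q else 0)"
      using that by (intro sum.cong) (auto simp: off)
    then show ?thesis using that finite_S by simp
  qed
  have const: "w q * D q q = (\<Sum>p\<in>S. w p * T p)" if w: "annihilates n d S w" and q: "q \<in> S" for w q
  proof -
    have "(\<Sum>p\<in>S. w p * (D p q - T p)) = 0"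
      using annihilates_deg_less[OF w] R by simp
    then show ?thesis using sum_D'[OF q, of w] by (simp add: right_diff_distrib sum_subtractf)
  qed
  obtain p0 where p0: "p0 \<in> S" using nonempty by blast
  \<comment> \<open>The \<open>n - 1\<close> forms \<open>f j\<close> vanish on \<open>S\<close>, so
    by \<open>dim_d\<close> there is one equation less than there are unknown weights.\<close>
  have "\<exists>u. annihilates n d S u \<and> (\<forall>v\<in>{}. u v = 0) \<and> (\<exists>v\<in>S. u v \<noteq> 0)"
    using n_d_bounds dim_d forms zero card_f
    by (intro annihilator_exists[OF finite_S _ _ independent_f(2)]) auto
  then obtain u p1 where u: "annihilates n d S u" "p1 \<in> S" "u p1 \<noteq> 0" by blast
  define k where "k = (\<Sum>p\<in>S. u p * T p)"
  have uk: "u q * D q q = k" if "q \<in> S" for q using const[OF u(1) that] by (simp add: k_def)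
  have k: "k \<noteq> 0" using uk[OF u(2)] u(3) diag[OF u(2)] by auto
  show thesis
  proof (rule that[of u])
    show "u p \<noteq> 0" if "p \<in> S" for p using uk[OF that] k by auto
    show "annihilates n d S u" by (rule u)
    show "\<exists>k. \<forall>p\<in>S. w p = k * u p" if w: "annihilates n d S w" for w
    proof (intro exI ballI)
      fix p assume p: "p \<in> S"
      have "w p * D p p = (\<Sum>p\<in>S. w p * T p) / k * (u p * D p p)"
        using const[OF w p] uk[OF p] k by simp
      then have "(w p - (\<Sum>p\<in>S. w p * T p) / k * u p) * D p p = 0" by (simp add: left_diff_distrib mult.assoc)
      then show "w p = (\<Sum>p\<in>S. w p * T p) / k * u p" using diag[OF p] by simp
    qed
    \<comment> \<open>The sum at \<open>p\<close> collapses to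
      \<open>x p * u p * D p p = k * x p\<close>, which recovers \<open>x\<close> up to the factor
      \<open>k\<close>.\<close>
    have interp: "x \<in> deg_less n S j" if "(\<lambda>p. \<Sum>q\<in>S. x q * u q * D p q) \<in> deg_less n S j" for x j
    proof (rule deg_less_cong)
      show "(\<lambda>p. 1 / k * (\<Sum>q\<in>S. x q * u q * D p q)) \<in> deg_less n S j"
        using that by (rule deg_less_scale)
      show "1 / k * (\<Sum>q\<in>S. x q * u q * D p q) = x p" if "p \<in> S" for p
        using sum_D[OF that, of "\<lambda>q. x q * u q"] uk[OF that] k by (simp add: mult.assoc)
    qed
    show "x \<in> deg_less n S (Suc d)" if x: "(\<Sum>p\<in>S. u p * x p) = 0" for x
    proof (rule interp)
      have "(\<lambda>p. \<Sum>q\<in>S. x q * u q * (D p q - T p)) \<in> deg_less n S (d + 1)"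
        by (intro deg_less_sum deg_less_scale R)
      \<comment> \<open>\<open>T p\<close> is free of \<open>q\<close>, so the relation on
        \<open>x\<close> removes exactly the part of degree \<open>d + 1\<close>.\<close>
      moreover have "(\<Sum>q\<in>S. x q * u q * (D p q - T p)) = (\<Sum>q\<in>S. x q * u q * D p q)" for p
      proof -
        have "(\<Sum>q\<in>S. x q * u q * (D p q - T p)) = (\<Sum>q\<in>S. x q * u q * D p q) - T p * (\<Sum>q\<in>S. u q * x q)"
          unfolding sum_distrib_left sum_subtractf[symmetric] by (rule sum.cong) (auto simp: algebra_simps)
        then show ?thesis using x by simp
      qed
      ultimately show "(\<lambda>p. \<Sum>q\<in>S. x q * u q * D p q) \<in> deg_less n S (Suc d)" by simp
    qed
    show "x \<in> deg_less n S (Suc (2 * d))" for x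
    proof (rule interp)
      have "(\<lambda>p. D p q - T p) \<in> deg_less n S (d + 2)" for q
        by (rule deg_less_mono[OF slice R]) simp_all
      from deg_less_add[OF T this] have D2: "(\<lambda>p. D p q) \<in> deg_less n S (d + 2)" for q
        by (simp del: deg_less.simps)
      have "(\<lambda>p. D p q) \<in> deg_less n S (Suc (2 * d))" for q
        using n_d_bounds by (intro deg_less_mono[OF slice D2]) simp_all
      then show "(\<lambda>p. \<Sum>q\<in>S. x q * u q * D p q) \<in> deg_less n S (Suc (2 * d))"
        by (intro deg_less_sum deg_less_scale)
    qed
  qed
qed

text \<open>With \<open>h\<close> outside the span, \<open>n\<close> independent forms would vanish
  on \<open>S\<close>, enough for a nonzero annihilating weight that is zero at a chosen point. But
  such weights are multiples of \<open>u\<close>, which has no zero on \<open>S\<close>.\<close>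

lemma vanishing_degree_d:
  assumes h: "h \<in> forms n d" and h0: "\<And>p. p \<in> S \<Longrightarrow> peval h p = 0"
  shows "h \<in> span (f ` {1..n - 1})"
proof (rule ccontr)
  assume h_span: "h \<notin> span (f ` {1..n - 1})"
  then have h_notin: "h \<notin> f ` {1..n - 1}" using span_base[of h "f ` {1..n - 1}"] by metis
  have indep: "independent (insert h (f ` {1..n - 1}))"
    unfolding independent_insert using h_notin h_span independent_f(2) by simp
  obtain p0 where p0: "p0 \<in> S" using nonempty by blast
  obtain u where u: "\<And>p. p \<in> S \<Longrightarrow> u p \<noteq> 0"
    "\<And>w. annihilates n d S w \<Longrightarrow> \<exists>k. \<forall>p\<in>S. w p = k * u p"
    by (rule cayley_bacharach) blast
  have "card (insert h (f ` {1..n - 1})) = n"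
    using h_notin n_d_bounds card_f by simp
  then have "dim (forms n d) + card {p0} < card S + card (insert h (f ` {1..n - 1}))"
    using dim_d by simp
  then have "\<exists>w. annihilates n d S w \<and> (\<forall>v\<in>{p0}. w v = 0) \<and> (\<exists>v\<in>S. w v \<noteq> 0)"
    using h h0 forms zero p0
    by (intro annihilator_exists[OF finite_S _ _ indep]) auto
  then obtain w p1 where w: "annihilates n d S w" "w p0 = 0" "p1 \<in> S" "w p1 \<noteq> 0" by blast
  then obtain k where "\<forall>p\<in>S. w p = k * u p" using u(2) by blast
  then show False using w p0 u(1) by auto
qed

text \<open>The products counted here, together with \<open>card S\<close> forms separating the points of \<open>S\<close>,
  fill up the whole space of forms of degree \<open>2 * d\<close>.\<close>

lemma noether:
  assumes g: "g \<in> forms n (2 * d)" and g0: "\<And>p. p \<in> S \<Longrightarrow> peval g p = 0"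
  shows "g \<in> span {f j * h |j h. j \<in> {1..n - 1} \<and> h \<in> forms n d}"
proof -
  let ?J = "{1..n - 1}"
  obtain B where B: "f ` ?J \<subseteq> B" "B \<subseteq> forms n d" "independent B" "forms n d \<subseteq> span B"
    using maximal_independent_subset_extend[of "f ` ?J" "forms n d"] forms independent_f(2) by blast
  note finB = forms_basis_card[OF B(3,2,4)]
  define B' where "B' = B - f ` ?J"
  have finB': "finite B'" using finB by (simp add: B'_def)
  have cardB': "card B' = card S - 1"
    using finB B(1) dim_d n_d_bounds card_f by (simp add: B'_def card_Diff_subset)
  define K where "K = {(j, k). j \<in> ?J \<and> k \<in> ?J \<and> j \<le> k}"
  have finK: "finite K" by (rule finite_subset[of _ "?J \<times> ?J"]) (auto simp: K_def)
  have cardK: "card K = n * (n - 1) div 2"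
  proof -
    have "K = (\<lambda>(k, j). (j, k)) ` (SIGMA k:?J. {1..k})" by (auto simp: K_def)
    then have "card K = card (SIGMA k:?J. {1..k})"
      by (simp add: card_image inj_on_def split_def prod_eq_iff)
    also have "\<dots> = (\<Sum>k\<in>?J. k)" by simp
    also have "\<dots> = (n - 1) * (n - 1 + 1) div 2" using gauss_sum_from_Suc_0[of "n - 1", where 'a = nat] by simp
    finally show ?thesis using n_d_bounds by (simp add: mult.commute)
  qed
  \<comment> \<open>Indices of the products: \<open>f j\<close> times a basis element complementary
    to the \<open>f k\<close>, and each product \<open>f j * f k\<close> once.\<close>
  define I where "I = (?J \<times> B') <+> K"
  define v where "v = case_sum (\<lambda>(j, b). f j * b) (\<lambda>(j, k). f j * f k)"
  have "\<forall>i\<in>I. a i = 0" if eq: "(\<Sum>i\<in>I. a i *\<^sub>R v i) = 0" for a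
  proof -
    define h where "h = (\<lambda>j. \<Sum>b\<in>B'. a (Inl (j, b)) *\<^sub>R b)"
    define m where "m = (\<lambda>j k. if j \<le> k then a (Inr (j, k)) else 0)"
    have h: "h j \<in> forms n d" for j
      using B(2) unfolding h_def B'_def by (intro forms_sum forms_scaleR) auto
    have "(\<Sum>i\<in>I. a i *\<^sub>R v i) = (\<Sum>x\<in>?J \<times> B'. a (Inl x) *\<^sub>R v (Inl x)) + (\<Sum>x\<in>K. a (Inr x) *\<^sub>R v (Inr x))"
      unfolding I_def using finB' finK by (subst sum.Plus) auto
    also have "(\<Sum>x\<in>?J \<times> B'. a (Inl x) *\<^sub>R v (Inl x)) = (\<Sum>j\<in>?J. f j * h j)"
      by (simp add: v_def h_def sum.cartesian_product' sum_distrib_left scaleR_mult_right)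
    also have "(\<Sum>x\<in>K. a (Inr x) *\<^sub>R v (Inr x)) = (\<Sum>x\<in>?J \<times> ?J. m (fst x) (snd x) *\<^sub>R (f (fst x) * f (snd x)))"
      by (rule sum.mono_neutral_cong_left) (auto simp: K_def m_def v_def)
    also have "\<dots> = (\<Sum>j\<in>?J. \<Sum>k\<in>?J. m j k *\<^sub>R (f j * f k))"
      by (simp add: sum.cartesian_product' )
    finally have rel: "(\<Sum>j\<in>?J. f j * h j) + (\<Sum>j\<in>?J. \<Sum>k\<in>?J. m j k *\<^sub>R (f j * f k)) = 0"
      using eq by simp
    \<comment> \<open>The relation is a syzygy whose coefficient at \<open>f j\<close> is
      \<open>h j\<close> plus a combination of the \<open>f k\<close>. The latter vanish on
      \<open>S\<close>, hence so will \<open>h j\<close>.\<close>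
    have hm0: "peval (h j + (\<Sum>k\<in>?J. m j k *\<^sub>R f k)) p = 0" if "p \<in> S" "j \<in> ?J" for p :: "nat \<Rightarrow> complex" and j
    proof (rule syzygy_vanishes[OF that(1) line_cont_peval _ that(2)])
      fix x :: "nat \<Rightarrow> complex"
      show "(\<Sum>j\<in>?J. peval (h j + (\<Sum>k\<in>?J. m j k *\<^sub>R f k)) x * peval (f j) x) = 0"
        using arg_cong[OF rel, of "\<lambda>q. peval q x"]
        by (simp add: distrib_left distrib_right sum.distrib sum_distrib_left sum_distrib_right mult_ac)
    qed
    have "peval (h j) p = 0" if "p \<in> S" "j \<in> ?J" for p :: "nat \<Rightarrow> complex" and j
      using hm0[OF that] zero[OF that(1)] by simp
    then have hspan: "h j \<in> span (f ` ?J)" if "j \<in> ?J" for j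
      using vanishing_degree_d[OF h] that by blast
    have aB: "a (Inl (j, b)) = 0" if j: "j \<in> ?J" and b: "b \<in> B'" for j b
    proof -
      obtain e where e: "h j = (\<Sum>b\<in>f ` ?J. e b *\<^sub>R b)"
        using hspan[OF j] by (auto simp: span_finite)
      \<comment> \<open>\<open>h j\<close> lies both in the span of the \<open>f k\<close> and in
        that of the complementary \<open>B'\<close>; subtracting the two expressions gives a
        relation on the basis \<open>B\<close>.\<close>
      let ?e = "\<lambda>b. if b \<in> f ` ?J then - e b else a (Inl (j, b))"
      have "(\<Sum>b\<in>B. ?e b *\<^sub>R b) = (\<Sum>b\<in>f ` ?J. ?e b *\<^sub>R b) + (\<Sum>b\<in>B'. ?e b *\<^sub>R b)"
        unfolding B'_def using finB(1) B(1) by (simp add: sum.subset_diff[OF B(1)] add.commute)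
      also have "(\<Sum>b\<in>f ` ?J. ?e b *\<^sub>R b) = - h j"
        unfolding e sum_negf[symmetric] by (rule sum.cong) auto
      also have "(\<Sum>b\<in>B'. ?e b *\<^sub>R b) = h j"
        unfolding h_def by (rule sum.cong) (auto simp: B'_def)
      finally have "(\<Sum>b\<in>B. ?e b *\<^sub>R b) = 0" by simp
      moreover have "b \<in> B" using b by (simp add: B'_def)
      ultimately have "?e b = 0"
        by (rule independentD[OF B(3) finB(1) order_refl])
      then show ?thesis using b by (simp add: B'_def)
    qed
    have "h j = 0" if "j \<in> ?J" for j using aB[OF that] by (simp add: h_def)
    then have rel': "(\<Sum>j\<in>?J. \<Sum>k\<in>?J. m j k *\<^sub>R (f j * f k)) = 0" using rel by simp
    have skew: "complex_of_real (m j k) + complex_of_real (m k j) = 0" if "j \<in> ?J" "k \<in> ?J" for j k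
    proof (rule quadratic_relation_skew[OF _ that, where m = "\<lambda>j k. complex_of_real (m j k)"])
      fix x :: "nat \<Rightarrow> complex"
      show "(\<Sum>j\<in>?J. \<Sum>k\<in>?J. complex_of_real (m j k) * (peval (f j) x * peval (f k) x)) = 0"
        using arg_cong[OF rel', of "\<lambda>q. peval q x"] by simp
    qed
    \<comment> \<open>\<open>m\<close> is upper triangular and skew symmetric, hence zero.\<close>
    have aK: "a (Inr (j, k)) = 0" if "(j, k) \<in> K" for j k
    proof -
      have "m j k + m k j = 0" using skew[of j k] that by (simp add: K_def flip: of_real_add)
      then show ?thesis using that by (cases "j = k") (auto simp: m_def K_def)
    qed
    show ?thesis using aB aK by (auto simp: I_def)
  qed
  moreover have finI: "finite I" using finB' finK by (simp add: I_def)
  ultimately have inj: "inj_on v I" and indep: "independent (v ` I)"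
    using independent_family[of I v] by auto
  have cardP: "card (v ` I) = (n - 1) * (card S - 1) + n * (n - 1) div 2"
    unfolding card_image[OF inj] using finB' finK
    by (simp add: I_def card_Plus card_cartesian_product cardB' cardK)
  have sub: "v ` I \<subseteq> {f j * h |j h. j \<in> ?J \<and> h \<in> forms n d}"
  proof -
    have "v i \<in> {f j * h |j h. j \<in> ?J \<and> h \<in> forms n d}" if i: "i \<in> I" for i
    proof (cases i)
      case (Inl x)
      then obtain j b where "x = (j, b)" "j \<in> ?J" "b \<in> B'" using i by (auto simp: I_def)
      moreover from this have "b \<in> forms n d" using B(2) by (auto simp: B'_def)
      ultimately show ?thesis using Inl by (auto simp: v_def)
    next
      case (Inr x)
      then obtain j k where "x = (j, k)" "j \<in> ?J" "k \<in> ?J" using i by (auto simp: I_def K_def)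
      moreover from this have "f k \<in> forms n d" by (intro forms)
      ultimately show ?thesis using Inr by (auto simp: v_def)
    qed
    then show ?thesis by blast
  qed
  \<comment> \<open>With one more independent form vanishing on \<open>S\<close>,
    \<open>dim_2d\<close> leaves fewer equations than points and hence a relation between the
    evaluations in degree \<open>2 * d\<close>, where all values are interpolated.\<close>
  have "g \<in> span (v ` I)"
  proof (rule ccontr)
    assume g_span: "g \<notin> span (v ` I)"
    then have g_notin: "g \<notin> v ` I" using span_base[of g "v ` I"] by metis
    have indep': "independent (insert g (v ` I))"
      unfolding independent_insert using g_notin g_span indep by simp
    have P: "q \<in> forms n (2 * d)" "p \<in> S \<Longrightarrow> peval q p = 0" if "q \<in> insert g (v ` I)" for q and p :: "nat \<Rightarrow> complex"
    proof -
      have "q = g \<or> (\<exists>j h. q = f j * h \<and> j \<in> ?J \<and> h \<in> forms n d)"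
      proof (cases "q = g")
        case False
        then have "q \<in> v ` I" using that by simp
        then have "q \<in> {f j * h |j h. j \<in> ?J \<and> h \<in> forms n d}" by (rule subsetD[OF sub])
        then show ?thesis by auto
      qed simp
      then consider "q = g" | j h where "q = f j * h" "j \<in> ?J" "h \<in> forms n d"
        by auto
      then have "q \<in> forms n (2 * d) \<and> (p \<in> S \<longrightarrow> peval q p = 0)"
      proof cases
        case 1
        then show ?thesis using g g0 by blast
      next
        case 2
        then show ?thesis using forms_mult[OF forms[OF 2(2)] 2(3)] zero[OF _ 2(2)] by (simp add: mult_2)
      qed
      then show "q \<in> forms n (2 * d)" "p \<in> S \<Longrightarrow> peval q p = 0" by auto
    qed
    have "card (insert g (v ` I)) = Suc ((n - 1) * (card S - 1) + n * (n - 1) div 2)"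
      using g_notin finI by (simp add: cardP)
    then have "dim (forms n (2 * d)) + card ({} :: (nat \<Rightarrow> complex) set) < card S + card (insert g (v ` I))"
      using dim_2d by simp
    then have "\<exists>w. annihilates n (2 * d) S w \<and> (\<forall>v\<in>{}. w v = 0) \<and> (\<exists>v\<in>S. w v \<noteq> 0)"
      using P by (intro annihilator_exists[OF finite_S _ _ indep']) blast+
    then obtain w p where w: "annihilates n (2 * d) S w" "p \<in> S" "w p \<noteq> 0" by blast
    have "x \<in> deg_less n S (Suc (2 * d))" for x by (rule cayley_bacharach) blast
    from annihilates_deg_less[OF w(1) this, of "\<lambda>q. if q = p then 1 else 0"]
    have "(\<Sum>q\<in>S. if q = p then w p else 0) = 0"
      by (simp add: if_distrib cong: if_cong)
    then show False using w finite_S by simp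
  qed
  then show ?thesis using span_mono[OF sub] by blast
qed

end

subsection \<open>Point functionals and conjugate pairs\<close>

abbreviation conj_vec :: "(nat \<Rightarrow> complex) \<Rightarrow> nat \<Rightarrow> complex" where
  "conj_vec v \<equiv> \<lambda>i. cnj (v i)"

lemma form_dual_sum:
  assumes l: "l \<in> form_dual n e" and "finite A" and p: "\<And>a. a \<in> A \<Longrightarrow> p a \<in> forms n e"
  shows "l (\<Sum>a\<in>A. p a) = (\<Sum>a\<in>A. l (p a))"
  using \<open>finite A\<close> p
proof (induction A rule: finite_induct)
  case empty
  have "l (0 *\<^sub>R 0) = 0 * l 0" using l forms_0 unfolding form_dual_def by blast
  then show ?case by simp
next
  case (insert a A)
  have "l (p a + (\<Sum>a\<in>A. p a)) = l (p a) + l (\<Sum>a\<in>A. p a)"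
    using l insert.prems forms_sum[of A p n e] unfolding form_dual_def by simp
  then show ?case using insert by simp
qed

lemma form_dual_add:
  "l \<in> form_dual n e \<Longrightarrow> p \<in> forms n e \<Longrightarrow> q \<in> forms n e \<Longrightarrow> l (p + q) = l p + l q"
  by (simp add: form_dual_def)

lemma form_dual_scaleR: "l \<in> form_dual n e \<Longrightarrow> p \<in> forms n e \<Longrightarrow> l (a *\<^sub>R p) = a * l p"
  by (simp add: form_dual_def)

lemma form_dual_diff:
  assumes "l \<in> form_dual n e" "p \<in> forms n e" "q \<in> forms n e"
  shows "l (p - q) = l p - l q"
  using form_dual_add[OF assms(1) forms_diff[OF assms(2,3)] assms(3)] by simp

lemma square_in_sos: "g \<in> forms n d \<Longrightarrow> g\<^sup>2 \<in> sos n d"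
  unfolding sos_def using forms_square by (auto intro!: exI[of _ "1::nat"] exI[of _ "\<lambda>_. g"])

text \<open>The polar form of \<open>quad_form l\<close> at \<open>f\<close> and \<open>h\<close> is
  \<open>l (f * h)\<close>.\<close>

lemma qf_kernel_mult:
  assumes l: "l \<in> form_dual n (2 * d)" and f: "f \<in> qf_kernel (forms n d) (quad_form l)"
    and h: "h \<in> forms n d"
  shows "l (f * h) = 0"
proof -
  have f': "f \<in> forms n d" using f by (simp add: qf_kernel_def)
  have fh: "f * h \<in> forms n (2 * d)" using forms_mult[OF f' h] by (simp add: mult_2)
  have "(f + h)\<^sup>2 = (f\<^sup>2 + h\<^sup>2) + 2 *\<^sub>R (f * h)"
    by (simp add: power2_eq_square algebra_simps scaleR_2)
  then have "l ((f + h)\<^sup>2) = l (f\<^sup>2) + l (h\<^sup>2) + 2 * l (f * h)"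
    by (simp add: form_dual_add[OF l] form_dual_scaleR[OF l] forms_add forms_scaleR forms_square f' h fh)
  moreover have "polar_form (quad_form l) f h = 0" using f h by (simp add: qf_kernel_def)
  ultimately show ?thesis by (simp add: polar_form_def quad_form_def)
qed

section \<open>Conjugation symmetry of the point set\<close>

locale conj_closed_points = transversal_points +
  assumes conj_closed: "\<And>v. v \<in> S \<Longrightarrow> conj_vec v \<in> S"
begin

lemma sum_conj: "(\<Sum>p\<in>S. F (conj_vec p)) = (\<Sum>p\<in>S. F p)"
  by (rule sum.reindex_bij_witness[of _ conj_vec conj_vec]) (auto simp: conj_closed)

text \<open>A complex interpolant splits as \<open>a + \<i> * b\<close> with real forms. Symmetric
  values are also taken by the conjugate interpolant \<open>a - \<i> * b\<close>, hence by
  \<open>a\<close>.\<close>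

lemma real_interpolation:
  assumes u: "(\<Sum>p\<in>S. u p * x p) = 0"
    and u_int: "\<And>x. (\<Sum>p\<in>S. u p * x p) = 0 \<Longrightarrow> x \<in> deg_less n S (Suc d)"
    and x: "\<And>p. p \<in> S \<Longrightarrow> x (conj_vec p) = cnj (x p)"
  obtains g where "g \<in> forms n d" "\<And>p. p \<in> S \<Longrightarrow> peval g p = x p"
proof -
  obtain a b where a: "a \<in> forms n d" and "b \<in> forms n d"
    and ab: "\<And>p. p \<in> S \<Longrightarrow> x p = peval a p + \<i> * peval b p"
    using u_int[OF u] by (auto simp: cforms_def)
  have "peval a p = x p" if p: "p \<in> S" for p
  proof -
    have "cnj (x p) = cnj (peval a p) + \<i> * cnj (peval b p)"
      using ab[OF conj_closed[OF p]] by (simp add: x p peval_cnj)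
    then have "cnj (cnj (x p)) = cnj (cnj (peval a p) + \<i> * cnj (peval b p))" by (rule arg_cong)
    then have "x p = peval a p - \<i> * peval b p" by simp
    then have "x p + x p = peval a p + peval a p" using ab[OF p] by simp
    then show ?thesis by simp
  qed
  with a show thesis by (rule that)
qed

text \<open>By uniqueness, adding the conjugate relation to \<open>u\<close> gives a multiple of
  \<open>u\<close>. If that multiple is zero, \<open>u\<close> is antisymmetric and
  \<open>\<i>\<close> times \<open>u\<close> is symmetric.\<close>

lemma conj_symmetric_relation:
  obtains u where "\<And>p. p \<in> S \<Longrightarrow> u p \<noteq> 0" "\<And>p. p \<in> S \<Longrightarrow> u (conj_vec p) = cnj (u p)"
    "\<And>x. (\<Sum>p\<in>S. u p * x p) = 0 \<Longrightarrow> x \<in> deg_less n S (Suc d)"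
proof -
  note witness = that
  obtain u where u: "\<And>p. p \<in> S \<Longrightarrow> u p \<noteq> 0" "annihilates n d S u"
    and uniq: "\<And>w. annihilates n d S w \<Longrightarrow> \<exists>k. \<forall>p\<in>S. w p = k * u p"
    and int: "\<And>x. (\<Sum>p\<in>S. u p * x p) = 0 \<Longrightarrow> x \<in> deg_less n S (Suc d)"
    by (rule cayley_bacharach) blast
  have *: thesis if k: "k \<noteq> 0" and w: "\<And>p. p \<in> S \<Longrightarrow> w p = k * u p"
    and sym: "\<And>p. p \<in> S \<Longrightarrow> w (conj_vec p) = cnj (w p)" for k w
  proof (rule witness[of w])
    show "w (conj_vec p) = cnj (w p)" if "p \<in> S" for p by (rule sym[OF that])
    show "w p \<noteq> 0" if "p \<in> S" for p using w u k that by simp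
    show "x \<in> deg_less n S (Suc d)" if x: "(\<Sum>p\<in>S. w p * x p) = 0" for x
    proof (rule int)
      have "(\<Sum>p\<in>S. w p * x p) = k * (\<Sum>p\<in>S. u p * x p)"
        unfolding sum_distrib_left by (rule sum.cong) (auto simp: w)
      then show "(\<Sum>p\<in>S. u p * x p) = 0" using x k by simp
    qed
  qed
  define w where "w = (\<lambda>p. u p + cnj (u (conj_vec p)))"
  have w_sym: "w (conj_vec p) = cnj (w p)" for p by (simp add: w_def)
  have "annihilates n d S w"
    unfolding annihilates_def
  proof
    fix p assume p: "p \<in> forms n d"
    have "(\<Sum>v\<in>S. cnj (u (conj_vec v)) * peval p v) = (\<Sum>v\<in>S. cnj (u v) * peval p (conj_vec v))"
      using sum_conj[of "\<lambda>v. cnj (u v) * peval p (conj_vec v)"] by simp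
    also have "\<dots> = cnj (\<Sum>v\<in>S. u v * peval p v)" by (simp add: peval_cnj)
    also have "\<dots> = 0" using u(2) p unfolding annihilates_def by (metis complex_cnj_zero)
    finally show "(\<Sum>v\<in>S. w v * peval p v) = 0"
      using u(2) p by (simp add: w_def annihilates_def distrib_right sum.distrib)
  qed
  then obtain k where k: "\<And>p. p \<in> S \<Longrightarrow> w p = k * u p" using uniq by blast
  show thesis
  proof (cases "k = 0")
    case True
    then have "cnj (u (conj_vec p)) = - u p" if "p \<in> S" for p
      using k[OF that] by (simp add: w_def add_eq_0_iff)
    then have "u (conj_vec p) = - cnj (u p)" if "p \<in> S" for p
      using that by (metis complex_cnj_cnj complex_cnj_minus)
    then show ?thesis by (intro *[of "\<i>" "\<lambda>p. \<i> * u p"]) auto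
  next
    case False
    then show ?thesis using k w_sym by (rule *)
  qed
qed

text \<open>By \<open>noether\<close> and the kernel hypothesis \<open>l\<close> depends only on the
  values on \<open>S\<close>. The first choice of the weight at \<open>q\<close> is the complex
  linear extension of \<open>l\<close> applied to a form that is 1 at \<open>q\<close> and 0 at the
  other points.\<close>

lemma point_functional:
  assumes l: "l \<in> form_dual n (2 * d)"
    and ker: "\<And>j. j \<in> {1..n - 1} \<Longrightarrow> f j \<in> qf_kernel (forms n d) (quad_form l)"
  obtains \<mu> where "\<And>p. p \<in> S \<Longrightarrow> \<mu> (conj_vec p) = cnj (\<mu> p)"
    "\<And>g. g \<in> forms n (2 * d) \<Longrightarrow> of_real (l g) = (\<Sum>p\<in>S. \<mu> p * peval g p)"
proof -
  have l0: "l g = 0" if g: "g \<in> forms n (2 * d)" "\<And>p. p \<in> S \<Longrightarrow> peval g p = 0" for g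
  proof -
    let ?Z = "{q \<in> forms n (2 * d). l q = 0}"
    have "subspace ?Z"
    proof (rule subspaceI)
      show "0 \<in> ?Z" using form_dual_sum[OF l, of "{}" "\<lambda>_. 0"] by simp
    qed (auto simp: form_dual_add[OF l] form_dual_scaleR[OF l] forms_add forms_scaleR)
    moreover have "{f j * h |j h. j \<in> {1..n - 1} \<and> h \<in> forms n d} \<subseteq> ?Z"
    proof safe
      fix j h assume j: "j \<in> {1..n - 1}" and h: "h \<in> forms n d"
      show "f j * h \<in> forms n (2 * d)" using forms_mult[OF forms[OF j] h] by (simp add: mult_2)
      show "l (f j * h) = 0" by (rule qf_kernel_mult[OF l ker[OF j] h])
    qed
    ultimately have "span {f j * h |j h. j \<in> {1..n - 1} \<and> h \<in> forms n d} \<subseteq> ?Z"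
      by (intro span_minimal)
    then show ?thesis using noether[OF g] by blast
  qed
  have "\<exists>a b. a \<in> forms n (2 * d) \<and> b \<in> forms n (2 * d) \<and>
      (\<forall>p\<in>S. (if p = q then 1 else 0) = peval a p + \<i> * peval b p)" for q
  proof -
    have "(\<lambda>p. if p = q then 1 else 0) \<in> deg_less n S (Suc (2 * d))"
      by (rule cayley_bacharach) blast
    then obtain a b where "a \<in> forms n (2 * d)" "b \<in> forms n (2 * d)"
      "\<forall>p\<in>S. (if p = q then 1 else 0) = peval a p + \<i> * peval b p"
      by (auto simp: cforms_def simp del: if_split)
    then show ?thesis by blast
  qed
  then obtain a b where a: "\<And>q. a q \<in> forms n (2 * d)" and b: "\<And>q. b q \<in> forms n (2 * d)"
    and ab: "\<And>p q. p \<in> S \<Longrightarrow> (if p = q then 1 else 0) = peval (a q) p + \<i> * peval (b q) p"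
    by metis
  define \<mu> where "\<mu> = (\<lambda>q. of_real (l (a q)) + \<i> * of_real (l (b q)))"
  have \<mu>: "of_real (l g) = (\<Sum>p\<in>S. \<mu> p * peval g p)" if g: "g \<in> forms n (2 * d)" for g
  proof -
    let ?re = "\<lambda>q. Re (peval g q)" and ?im = "\<lambda>q. Im (peval g q)"
    \<comment> \<open>\<open>h\<close> and \<open>k\<close> are the real and imaginary coefficient
      parts of the Lagrange interpolant of \<open>g\<close>. As \<open>g\<close> is real,
      \<open>g - h\<close> and \<open>k\<close> vanish on \<open>S\<close>.\<close>
    define h where "h = (\<Sum>q\<in>S. ?re q *\<^sub>R a q - ?im q *\<^sub>R b q)"
    define k where "k = (\<Sum>q\<in>S. ?im q *\<^sub>R a q + ?re q *\<^sub>R b q)"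
    have hf: "h \<in> forms n (2 * d)" and kf: "k \<in> forms n (2 * d)"
      unfolding h_def k_def by (intro forms_sum forms_diff forms_add forms_scaleR a b)+
    have hk: "peval g p = peval h p + \<i> * peval k p" if p: "p \<in> S" for p
    proof -
      have "peval h p + \<i> * peval k p =
          (\<Sum>q\<in>S. (of_real (?re q) + \<i> * of_real (?im q)) * (peval (a q) p + \<i> * peval (b q) p))"
        unfolding h_def k_def peval_sum sum_distrib_left sum.distrib[symmetric]
        by (rule sum.cong) (auto simp: algebra_simps)
      also have "\<dots> = (\<Sum>q\<in>S. if q = p then peval g p else 0)"
      proof (rule sum.cong[OF refl])
        fix q
        have "of_real (?re q) + \<i> * of_real (?im q) = peval g q" by (rule complex_eq[symmetric])
        then show "(of_real (?re q) + \<i> * of_real (?im q)) * (peval (a q) p + \<i> * peval (b q) p) =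
            (if q = p then peval g p else 0)"
          unfolding ab[OF p, symmetric] by auto
      qed
      finally show ?thesis using p finite_S by simp
    qed
    have "peval (g - h) p = 0 \<and> peval k p = 0" if p: "p \<in> S" for p
    proof -
      have "cnj (peval g p) = cnj (peval h p) + \<i> * cnj (peval k p)"
        using hk[OF conj_closed[OF p]] by (simp add: peval_cnj)
      then have "cnj (cnj (peval g p)) = cnj (cnj (peval h p) + \<i> * cnj (peval k p))" by (rule arg_cong)
      then have "peval g p = peval h p - \<i> * peval k p" by simp
      then show ?thesis using hk[OF p] by simp
    qed
    then have "l (g - h) = 0" "l k = 0" using l0[OF forms_diff[OF g hf]] l0[OF kf] by blast+
    then have lg: "l g = l h" and lk: "l k = 0" using form_dual_diff[OF l g hf] by auto
    have lh: "l h = (\<Sum>q\<in>S. ?re q * l (a q) - ?im q * l (b q))"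
      unfolding h_def using a b finite_S
      by (simp add: form_dual_sum[OF l] form_dual_diff[OF l] form_dual_scaleR[OF l] forms_diff forms_scaleR)
    have lk': "l k = (\<Sum>q\<in>S. ?im q * l (a q) + ?re q * l (b q))"
      unfolding k_def using a b finite_S
      by (simp add: form_dual_sum[OF l] form_dual_add[OF l] form_dual_scaleR[OF l] forms_add forms_scaleR)
    have "(\<Sum>p\<in>S. \<mu> p * peval g p) = of_real (l h) + \<i> * of_real (l k)"
      unfolding lh lk' of_real_sum sum_distrib_left sum.distrib[symmetric]
    proof (rule sum.cong[OF refl])
      fix q
      have "\<mu> q * peval g q = \<mu> q * (of_real (?re q) + \<i> * of_real (?im q))" by (simp flip: complex_eq)
      then show "\<mu> q * peval g q = of_real (?re q * l (a q) - ?im q * l (b q)) +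
          \<i> * of_real (?im q * l (a q) + ?re q * l (b q))"
        by (simp add: \<mu>_def algebra_simps)
    qed
    then show ?thesis using lg lk by simp
  qed
  \<comment> \<open>Averaging with the conjugate makes the weights symmetric; the sum is unchanged
    because \<open>l g\<close> is real.\<close>
  define \<nu> where "\<nu> = (\<lambda>p. (\<mu> p + cnj (\<mu> (conj_vec p))) / 2)"
  show thesis
  proof (rule that)
    show "\<nu> (conj_vec p) = cnj (\<nu> p)" for p by (simp add: \<nu>_def add.commute)
    fix g assume g: "g \<in> forms n (2 * d)"
    have "(\<Sum>p\<in>S. cnj (\<mu> (conj_vec p)) * peval g p) = (\<Sum>p\<in>S. cnj (\<mu> p) * peval g (conj_vec p))"
      using sum_conj[of "\<lambda>p. cnj (\<mu> p) * peval g (conj_vec p)"] by simp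
    also have "\<dots> = cnj (\<Sum>p\<in>S. \<mu> p * peval g p)" by (simp add: peval_cnj)
    also have "\<dots> = of_real (l g)" by (simp flip: \<mu>[OF g])
    finally have "(\<Sum>p\<in>S. (\<mu> p + cnj (\<mu> (conj_vec p))) * peval g p) = 2 * of_real (l g)"
      by (simp add: distrib_right sum.distrib flip: \<mu>[OF g])
    moreover have "(\<Sum>p\<in>S. \<nu> p * peval g p) = (\<Sum>p\<in>S. (\<mu> p + cnj (\<mu> (conj_vec p))) * peval g p) / 2"
      unfolding sum_divide_distrib by (rule sum.cong) (auto simp: \<nu>_def)
    ultimately show "of_real (l g) = (\<Sum>p\<in>S. \<nu> p * peval g p)" by simp
  qed
qed

text \<open>Symmetric values supported on \<open>v\<close> and its conjugate. If \<open>v\<close> is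
  real both terms are active, and the value there is \<open>2 * Re \<xi>\<close>.\<close>

definition conj_pair :: "(nat \<Rightarrow> complex) \<Rightarrow> complex \<Rightarrow> (nat \<Rightarrow> complex) \<Rightarrow> complex" where
  "conj_pair v \<xi> p = (if p = v then \<xi> else 0) + (if p = conj_vec v then cnj \<xi> else 0)"

lemma conj_vec_eq_iff: "conj_vec p = v \<longleftrightarrow> p = conj_vec v"
proof
  show "p = conj_vec v" if "conj_vec p = v" unfolding that[symmetric] by simp
  show "conj_vec p = v" if "p = conj_vec v" unfolding that by simp
qed

lemma conj_pair_sym: "conj_pair v \<xi> (conj_vec p) = cnj (conj_pair v \<xi> p)"
  unfolding conj_pair_def conj_vec_eq_iff by simp

lemma sum_conj_pair:
  assumes v: "v \<in> S" and u: "u (conj_vec v) = cnj (u v)"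
  shows "(\<Sum>p\<in>S. u p * conj_pair v \<xi> p) = of_real (2 * Re (u v * \<xi>))"
proof -
  have "(\<Sum>p\<in>S. u p * conj_pair v \<xi> p) =
      (\<Sum>p\<in>S. if p = v then u p * \<xi> else 0) + (\<Sum>p\<in>S. if p = conj_vec v then u p * cnj \<xi> else 0)"
    unfolding sum.distrib[symmetric] by (rule sum.cong) (auto simp: conj_pair_def algebra_simps)
  also have "\<dots> = u v * \<xi> + cnj (u v * \<xi>)"
    using v conj_closed[OF v] finite_S by (simp add: u)
  finally show ?thesis by (simp only: complex_add_cnj)
qed

text \<open>The two points are distinct, so squaring the values amounts to squaring
  \<open>\<xi>\<close>. The argument of \<open>\<xi>\<close> is free, which is where negative values
  come from.\<close>

lemma sum_conj_pair_square:
  assumes v: "v \<in> S" and "conj_vec v \<noteq> v" and \<mu>: "\<mu> (conj_vec v) = cnj (\<mu> v)"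
  shows "(\<Sum>p\<in>S. \<mu> p * (conj_pair v \<xi> p)\<^sup>2) = of_real (2 * Re (\<mu> v * \<xi>\<^sup>2))"
proof -
  have "(conj_pair v \<xi> p)\<^sup>2 = conj_pair v (\<xi>\<^sup>2) p" for p
    using assms(2) by (auto simp: conj_pair_def)
  then show ?thesis using sum_conj_pair[OF v \<mu>] by simp
qed

lemma sum_conj_pair_square_real:
  assumes v: "v \<in> S" and "conj_vec v = v"
  shows "(\<Sum>p\<in>S. \<mu> p * (conj_pair v \<xi> p)\<^sup>2) = \<mu> v * of_real (4 * (Re \<xi>)\<^sup>2)"
proof -
  have "(\<Sum>p\<in>S. \<mu> p * (conj_pair v \<xi> p)\<^sup>2) = (\<Sum>p\<in>S. if p = v then \<mu> v * (\<xi> + cnj \<xi>)\<^sup>2 else 0)"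
    using assms(2) by (intro sum.cong) (auto simp: conj_pair_def)
  also have "\<dots> = \<mu> v * (\<xi> + cnj \<xi>)\<^sup>2" using v finite_S by simp
  finally show ?thesis by (simp add: complex_add_cnj power_mult_distrib)
qed

text \<open>A conjugate pair of points contributes a hyperbolic plane to the quadratic form of \<open>l\<close>,
  whereas the forms of degree \<open>d\<close> fill a hyperplane in the space of conjugation symmetric values
  on \<open>S\<close>.\<close>

theorem at_most_one_conj_pair:
  assumes ext: "spans_extreme_ray n d l" and not_eval: "\<not> is_point_evaluation n (2 * d) l"
    and ker: "\<And>j. j \<in> {1..n - 1} \<Longrightarrow> f j \<in> qf_kernel (forms n d) (quad_form l)"
    and v1: "v1 \<in> S" "conj_vec v1 \<noteq> v1" and v2: "v2 \<in> S" "conj_vec v2 \<noteq> v2"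
    and v12: "v2 \<noteq> v1" "v2 \<noteq> conj_vec v1"
  shows False
proof -
  have l: "l \<in> form_dual n (2 * d)" and l_sos: "\<And>p. p \<in> sos n d \<Longrightarrow> l p \<ge> 0"
    using ext by (auto simp: spans_extreme_ray_def sos_dual_def)
  obtain \<mu> where \<mu>_sym: "\<And>p. p \<in> S \<Longrightarrow> \<mu> (conj_vec p) = cnj (\<mu> p)"
    and \<mu>: "\<And>g. g \<in> forms n (2 * d) \<Longrightarrow> of_real (l g) = (\<Sum>p\<in>S. \<mu> p * peval g p)"
    by (rule point_functional[OF l ker]) blast+
  obtain u where u0: "\<And>p. p \<in> S \<Longrightarrow> u p \<noteq> 0" and u_sym: "\<And>p. p \<in> S \<Longrightarrow> u (conj_vec p) = cnj (u p)"
    and u_int: "\<And>x. (\<Sum>p\<in>S. u p * x p) = 0 \<Longrightarrow> x \<in> deg_less n S (Suc d)"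
    by (rule conj_symmetric_relation) blast
  define N where "N = (\<lambda>v \<xi>. \<Sum>p\<in>S. \<mu> p * (conj_pair v \<xi> p)\<^sup>2)"
  \<comment> \<open>Symmetric values supported on \<open>v\<close>, \<open>w\<close> and their
    conjugates that satisfy the relation \<open>u\<close> come from a real form \<open>g\<close>,
    and \<open>l\<close> is nonnegative on its square.\<close>
  have psd: "Re (N v \<xi>) + Re (N w \<eta>) \<ge> 0"
    if vw: "v \<in> S" "w \<in> S" "w \<noteq> v" "w \<noteq> conj_vec v" and rel: "Re (u v * \<xi>) + Re (u w * \<eta>) = 0"
    for v w \<xi> \<eta>
  proof -
    let ?x = "\<lambda>p. conj_pair v \<xi> p + conj_pair w \<eta> p"
    have "(\<Sum>p\<in>S. u p * ?x p) = of_real (2 * Re (u v * \<xi>)) + of_real (2 * Re (u w * \<eta>))"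
      using sum_conj_pair[OF vw(1) u_sym[OF vw(1)]] sum_conj_pair[OF vw(2) u_sym[OF vw(2)]]
      by (simp add: distrib_left sum.distrib)
    also have "\<dots> = of_real (2 * (Re (u v * \<xi>) + Re (u w * \<eta>)))" by (simp only: of_real_add distrib_left)
    also have "\<dots> = 0" by (simp only: rel mult_zero_right of_real_0)
    finally have sum0: "(\<Sum>p\<in>S. u p * ?x p) = 0" .
    obtain g where g: "g \<in> forms n d" "\<And>p. p \<in> S \<Longrightarrow> peval g p = ?x p"
      using real_interpolation[OF sum0 u_int] by (auto simp: conj_pair_sym)
    have prod0: "conj_pair v \<xi> p * conj_pair w \<eta> p = 0" for p
    proof -
      have "conj_vec w \<noteq> v" "conj_vec w \<noteq> conj_vec v" unfolding conj_vec_eq_iff using vw(3,4) by simp_all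
      then show ?thesis using vw(3,4) by (auto simp: conj_pair_def)
    qed
    have "of_real (l (g\<^sup>2)) = (\<Sum>p\<in>S. \<mu> p * (?x p)\<^sup>2)"
      using \<mu>[OF forms_square[OF g(1)]] g(2) by simp
    also have "\<dots> = N v \<xi> + N w \<eta>"
      unfolding N_def sum.distrib[symmetric]
    proof (rule sum.cong[OF refl])
      fix p
      have "(?x p)\<^sup>2 = (conj_pair v \<xi> p)\<^sup>2 + (conj_pair w \<eta> p)\<^sup>2"
        using prod0[of p] by (simp add: power2_sum mult.assoc)
      then show "\<mu> p * (?x p)\<^sup>2 = \<mu> p * (conj_pair v \<xi> p)\<^sup>2 + \<mu> p * (conj_pair w \<eta> p)\<^sup>2"
        by (simp add: distrib_left)
    qed
    finally have "l (g\<^sup>2) = Re (N v \<xi> + N w \<eta>)" by (metis Re_complex_of_real)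
    then show ?thesis using l_sos[OF square_in_sos[OF g(1)]] by simp
  qed
  have N_nonreal: "Re (N v \<xi>) = 2 * Re (\<mu> v * \<xi>\<^sup>2)" if "v \<in> S" "conj_vec v \<noteq> v" for v \<xi>
    unfolding N_def sum_conj_pair_square[OF that \<mu>_sym[OF that(1)]] by simp
  \<comment> \<open>With this choice of \<open>\<xi>\<close> the term
    \<open>\<mu> v * \<xi>\<^sup>2\<close> is real, and negative unless
    \<open>s = 0\<close>.\<close>
  have root: "\<mu> v * (of_real s * csqrt (- 1 / \<mu> v))\<^sup>2 = - of_real (s\<^sup>2)" if "\<mu> v \<noteq> 0" for v s
    using that by (simp add: power_mult_distrib)
  have "\<exists>v\<in>S. conj_vec v \<noteq> v \<and> \<mu> v = 0"
  proof (rule ccontr)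
    assume "\<not> ?thesis"
    then have \<mu>0: "\<mu> v1 \<noteq> 0" "\<mu> v2 \<noteq> 0" using v1 v2 by auto
    let ?\<alpha> = "Re (u v1 * csqrt (- 1 / \<mu> v1))" and ?\<beta> = "Re (u v2 * csqrt (- 1 / \<mu> v2))"
    \<comment> \<open>Two negative directions against one linear condition: some nonzero combination
      of them satisfies the relation.\<close>
    have "\<exists>s t. s * \<alpha> + t * \<beta> = 0 \<and> (s \<noteq> 0 \<or> t \<noteq> 0)" for \<alpha> \<beta> :: real
    proof (cases "\<alpha> = 0 \<and> \<beta> = 0")
      case False
      then show ?thesis by (intro exI[of _ \<beta>] exI[of _ "- \<alpha>"]) auto
    qed auto
    then obtain s t :: real where st: "s * ?\<alpha> + t * ?\<beta> = 0" "s \<noteq> 0 \<or> t \<noteq> 0" by blast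
    have "Re (N v1 (of_real s * csqrt (- 1 / \<mu> v1))) + Re (N v2 (of_real t * csqrt (- 1 / \<mu> v2))) \<ge> 0"
    proof (rule psd[OF v1(1) v2(1) v12])
      have scale: "Re (z * (of_real r * y)) = r * Re (z * y)" for r z y
        by (simp add: algebra_simps)
      show "Re (u v1 * (of_real s * csqrt (- 1 / \<mu> v1))) + Re (u v2 * (of_real t * csqrt (- 1 / \<mu> v2))) = 0"
        unfolding scale by (rule st(1))
    qed
    then have "- (s\<^sup>2) - t\<^sup>2 \<ge> 0"
      unfolding N_nonreal[OF v1] N_nonreal[OF v2] root[OF \<mu>0(1)] root[OF \<mu>0(2)] by simp
    moreover have "s\<^sup>2 + t\<^sup>2 > 0" using st(2) by (simp add: sum_power2_gt_zero_iff)
    ultimately show False by simp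
  qed
  then obtain v where v: "v \<in> S" "conj_vec v \<noteq> v" "\<mu> v = 0" by blast
  \<comment> \<open>Since \<open>\<mu> v = 0\<close>, the value at \<open>v\<close> can be chosen to
    satisfy the relation without affecting the quadratic form.\<close>
  have psd': "Re (N w \<eta>) \<ge> 0" if w: "w \<in> S" "w \<noteq> v" "w \<noteq> conj_vec v" for w \<eta>
  proof -
    let ?\<xi> = "of_real (- Re (u w * \<eta>)) / u v"
    have "Re (N v ?\<xi>) + Re (N w \<eta>) \<ge> 0"
      using u0[OF v(1)] by (intro psd v w) simp
    then show ?thesis using N_nonreal[OF v(1,2)] v(3) by simp
  qed
  have \<mu>_nonreal: "\<mu> w = 0" if w: "w \<in> S" "conj_vec w \<noteq> w" for w
  proof (rule ccontr)
    assume w0: "\<mu> w \<noteq> 0"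
    have "w \<noteq> v" "w \<noteq> conj_vec v" using w0 v(3) \<mu>_sym[OF v(1)] by auto
    then have "Re (N w (of_real 1 * csqrt (- 1 / \<mu> w))) \<ge> 0" by (intro psd' w)
    then show False unfolding N_nonreal[OF w] root[OF w0] by simp
  qed
  have \<mu>_real: "\<mu> w = of_real (Re (\<mu> w))" "Re (\<mu> w) \<ge> 0" if w: "w \<in> S" "conj_vec w = w" for w
  proof -
    have "cnj (\<mu> w) = \<mu> w" using \<mu>_sym[OF w(1)] w(2) by simp
    then show "\<mu> w = of_real (Re (\<mu> w))" by (simp add: complex_eq_iff)
    have "w \<noteq> v" using v(2) w(2) by auto
    moreover have "w \<noteq> conj_vec v"
    proof
      assume "w = conj_vec v"
      then have "conj_vec w = v" unfolding conj_vec_eq_iff .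
      then show False using \<open>w \<noteq> v\<close> w(2) by simp
    qed
    \<comment> \<open>At a real point \<open>1 / 2\<close> gives the value 1, so \<open>N\<close>
      returns the weight itself.\<close>
    ultimately have "Re (N w (1 / 2)) \<ge> 0" by (intro psd' w)
    then show "Re (\<mu> w) \<ge> 0" unfolding N_def sum_conj_pair_square_real[OF w] by (simp add: power2_eq_square)
  qed
  define re where "re = (\<lambda>(p :: nat \<Rightarrow> complex) i. Re (p i))"
  have re: "peval g w = of_real (peval g (re w))" if "conj_vec w = w" for g w
  proof -
    have "w = (\<lambda>i. of_real (re w i))"
    proof
      fix i
      have "cnj (w i) = w i" using that by (rule fun_cong)
      then show "w i = of_real (re w i)" by (simp add: re_def complex_eq_iff)
    qed
    then show ?thesis using peval_of_real[of g "re w", where 'a = complex] by simp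
  qed
  have l_eq: "l g = (\<Sum>p\<in>S. Re (\<mu> p) * peval g (re p))" if g: "g \<in> forms n (2 * d)" for g
  proof -
    have "complex_of_real (l g) = (\<Sum>p\<in>S. of_real (Re (\<mu> p) * peval g (re p)))"
      unfolding \<mu>[OF g]
    proof (rule sum.cong[OF refl])
      fix p assume p: "p \<in> S"
      show "\<mu> p * peval g p = of_real (Re (\<mu> p) * peval g (re p))"
        using \<mu>_nonreal[OF p] \<mu>_real(1)[OF p] re[of p g] by (cases "conj_vec p = p") (simp, simp)
    qed
    then show ?thesis by (simp only: of_real_sum[symmetric] of_real_eq_iff)
  qed
  have weight: "Re (\<mu> p) \<ge> 0" if "p \<in> S" for p
    using \<mu>_nonreal[OF that] \<mu>_real(2)[OF that] by (cases "conj_vec p = p") auto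
  obtain g0 where g0: "g0 \<in> forms n (2 * d)" "l g0 \<noteq> 0"
    using ext by (auto simp: spans_extreme_ray_def)
  obtain q where q: "q \<in> S" "Re (\<mu> q) \<noteq> 0"
  proof (rule ccontr)
    assume "\<not> thesis"
    then have "\<forall>q\<in>S. Re (\<mu> q) = 0" using that by blast
    then have "l g0 = 0" using l_eq[OF g0(1)] by simp
    then show False using g0(2) by simp
  qed
  have q_real: "conj_vec q = q"
  proof (rule ccontr)
    assume "conj_vec q \<noteq> q"
    then show False using \<mu>_nonreal[OF q(1)] q(2) by simp
  qed
  \<comment> \<open>One real point with nonzero weight is split off; extremality makes
    \<open>l1\<close> a multiple of \<open>l\<close>.\<close>
  define l1 where "l1 = (\<lambda>g. Re (\<mu> q) * peval g (re q))"
  define l2 where "l2 = (\<lambda>g. \<Sum>p\<in>S - {q}. Re (\<mu> p) * peval g (re p))"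
  have nonneg: "peval g (w :: nat \<Rightarrow> real) \<ge> 0" if "g \<in> sos n d" for g w
    using that by (auto simp: sos_def intro!: sum_nonneg)
  have l1: "l1 \<in> sos_dual n d"
    using weight[OF q(1)] nonneg by (auto simp: sos_dual_def form_dual_def l1_def distrib_left)
  have l2: "l2 \<in> sos_dual n d"
    using weight nonneg unfolding sos_dual_def form_dual_def l2_def
    by (auto simp: distrib_left sum.distrib sum_distrib_left mult_ac intro!: sum_nonneg)
  have "l g = l1 g + l2 g" if "g \<in> forms n (2 * d)" for g
    unfolding l_eq[OF that] l1_def l2_def using q(1) finite_S by (simp add: sum.remove)
  then obtain k where k: "\<And>g. g \<in> forms n (2 * d) \<Longrightarrow> l1 g = k * l g"
    using ext l1 l2 unfolding spans_extreme_ray_def by blast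
  \<comment> \<open>For \<open>k \<noteq> 0\<close>: evaluation at \<open>q\<close> is not the zero
    functional, as the constant 1 is interpolated in degree \<open>2 * d\<close>.\<close>
  have "\<exists>g\<in>forms n (2 * d). peval g q \<noteq> 0"
  proof (rule ccontr)
    assume none: "\<not> ?thesis"
    have "(\<lambda>_. 1) \<in> deg_less n S (Suc (2 * d))" by (rule cayley_bacharach) blast
    then obtain a b where "a \<in> forms n (2 * d)" "b \<in> forms n (2 * d)" "1 = peval a q + \<i> * peval b q"
      using q(1) by (auto simp: cforms_def)
    then show False using none by auto
  qed
  then obtain g where "g \<in> forms n (2 * d)" "l1 g \<noteq> 0"
    using re[OF q_real] q(2) by (auto simp: l1_def)
  then have "k \<noteq> 0" using k by auto
  then have "\<forall>g\<in>forms n (2 * d). l g = Re (\<mu> q) / k * peval g (re q)"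
    using k by (auto simp: l1_def field_simps)
  then show False using not_eval unfolding is_point_evaluation_def by blast
qed

end

subsection \<open>Projective points\<close>

text \<open>Coefficients on the moment curve \<open>1, t, t^2, ...\<close>: at each vector the value
  is a nonzero polynomial in \<open>t\<close> with finitely many roots, and there are infinitely
  many real \<open>t\<close>.\<close>

lemma common_nonvanishing_linear_form:
  assumes "finite V" "V \<subseteq> nonzero_vecs n"
  obtains c :: "nat \<Rightarrow> real" where "\<And>v. v \<in> V \<Longrightarrow> (\<Sum>i<n. of_real (c i) * v i) \<noteq> 0"
proof -
  have "finite {z. (\<Sum>i\<le>n - 1. v i * z ^ i) = 0}" if "v \<in> V" for v
  proof -
    obtain i where "i < n" "v i \<noteq> 0" using \<open>v \<in> V\<close> assms(2) by (auto simp: nonzero_vecs_def)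
    then have "\<exists>i\<le>n - 1. v i \<noteq> 0" by (intro exI[of _ i]) auto
    then show ?thesis by (simp only: polyfun_finite_roots)
  qed
  then have fin: "finite (\<Union>v\<in>V. {z. (\<Sum>i\<le>n - 1. v i * z ^ i) = 0})" using assms(1) by blast
  have "infinite (range complex_of_real)"
    by (simp add: finite_image_iff inj_of_real infinite_UNIV_char_0)
  then have "infinite (range complex_of_real - (\<Union>v\<in>V. {z. (\<Sum>i\<le>n - 1. v i * z ^ i) = 0}))"
    by (rule Diff_infinite_finite[OF fin])
  from infinite_imp_nonempty[OF this]
  obtain z where z: "z \<in> range complex_of_real"
      "z \<notin> (\<Union>v\<in>V. {z. (\<Sum>i\<le>n - 1. v i * z ^ i) = 0})"
    by auto
  then obtain t where t: "z = complex_of_real t" by blast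
  show thesis
  proof (rule that[of "\<lambda>i. t ^ i"])
    fix v assume v: "v \<in> V"
    then have "n \<noteq> 0" using assms(2) by (auto simp: nonzero_vecs_def)
    then have "{..<n} = {..n - 1}" by auto
    then show "(\<Sum>i<n. of_real (t ^ i) * v i) \<noteq> 0"
      using z(2) v by (simp add: t mult.commute)
  qed
qed

lemma proj_class: "v \<in> nonzero_vecs n \<Longrightarrow> proj_rel n `` {v} \<in> proj_space n"
  unfolding proj_space_def by (rule quotientI)

lemma proj_class_iff:
  "v \<in> nonzero_vecs n \<Longrightarrow> w \<in> proj_rel n `` {v} \<longleftrightarrow> (\<exists>k. k \<noteq> 0 \<and> w = (\<lambda>i. k * v i))"
  by (auto simp: proj_rel_def nonzero_vecs_def)

lemma proj_space_class:
  assumes "P \<in> proj_space n" "v \<in> P"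
  shows "v \<in> nonzero_vecs n" "P = proj_rel n `` {v}"
proof -
  obtain w where w: "w \<in> nonzero_vecs n" "P = proj_rel n `` {w}"
    using assms(1) unfolding proj_space_def by (rule quotientE)
  then have wv: "(w, v) \<in> proj_rel n" using assms(2) by simp
  then show "v \<in> nonzero_vecs n" by (simp add: proj_rel_def)
  show "P = proj_rel n `` {v}" using equiv_class_eq[OF equiv_proj_rel wv] w by simp
qed

lemma proj_space_nonempty: "P \<in> proj_space n \<Longrightarrow> \<exists>v. v \<in> P"
  using in_quotient_imp_non_empty[OF equiv_proj_rel] unfolding proj_space_def by blast

lemma conj_nonzero_vecs: "v \<in> nonzero_vecs n \<Longrightarrow> conj_vec v \<in> nonzero_vecs n"
  by (simp add: nonzero_vecs_def)

lemma conj_point_class: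
  assumes v: "v \<in> nonzero_vecs n"
  shows "conj_point (proj_rel n `` {v}) = proj_rel n `` {conj_vec v}"
proof (intro equalityI subsetI)
  fix w assume "w \<in> conj_point (proj_rel n `` {v})"
  then obtain x where x: "x \<in> proj_rel n `` {v}" "w = conj_vec x"
    unfolding conj_point_def by (rule imageE)
  obtain k where "k \<noteq> 0" "x = (\<lambda>i. k * v i)"
    using iffD1[OF proj_class_iff[OF v] x(1)] by blast
  with x(2) have "k \<noteq> 0" "w = conj_vec (\<lambda>i. k * v i)" by auto
  then show "w \<in> proj_rel n `` {conj_vec v}"
    unfolding proj_class_iff[OF conj_nonzero_vecs[OF v]] by (intro exI[of _ "cnj k"]) simp
next
  fix w assume "w \<in> proj_rel n `` {conj_vec v}"
  then obtain k where k: "k \<noteq> 0" "w = (\<lambda>i. k * cnj (v i))"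
    unfolding proj_class_iff[OF conj_nonzero_vecs[OF v]] by blast
  then have "w = conj_vec (\<lambda>i. cnj k * v i)" by simp
  moreover have "(\<lambda>i. cnj k * v i) \<in> proj_rel n `` {v}"
    unfolding proj_class_iff[OF v] using k by (intro exI[of _ "cnj k"]) simp
  ultimately show "w \<in> conj_point (proj_rel n `` {v})" unfolding conj_point_def by (rule image_eqI)
qed

section \<open>Passage from projective points to normalised vectors\<close>

theorem corollary4p4:
  fixes n d :: nat
    and l :: "rpoly \<Rightarrow> real"
    and f :: "nat \<Rightarrow> rpoly"
    and \<Gamma> :: "(nat \<Rightarrow> complex) set set"
  assumes "(n, 2 * d) = (3, 6) \<or> (n, 2 * d) = (4, 4)"
    and "spans_extreme_ray n d l"
    and "\<not> is_point_evaluation n (2 * d) l"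
    and "\<forall>j \<in> {1..n - 1}. f j \<in> qf_kernel (forms n d) (quad_form l)"
    and "intersect_transversely n f"
    and "\<Gamma> = common_zeros n f"
    and "card \<Gamma> = d ^ (n - 1)"
  shows "(\<forall>\<gamma> \<in> \<Gamma>. real_point \<gamma>) \<or>
    (\<exists>\<gamma> \<in> \<Gamma>. \<not> real_point \<gamma> \<and> conj_point \<gamma> \<in> \<Gamma> \<and>
       (\<forall>\<delta> \<in> \<Gamma> - {\<gamma>, conj_point \<gamma>}. real_point \<delta>))"
proof -
  have nd: "n = 3 \<and> d = 3 \<or> n = 4 \<and> d = 2" using assms(1) by auto
  have f: "f j \<in> forms n d" if "j \<in> {1..n - 1}" for j
    using assms(4) that by (auto simp: qf_kernel_def)
  have fin\<Gamma>: "finite \<Gamma>" using assms(5,6) by (simp add: intersect_transversely_def)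
  have \<Gamma>_proj: "P \<in> proj_space n" if "P \<in> \<Gamma>" for P
    using that assms(6) by (simp add: common_zeros_def)
  obtain rep where rep: "\<And>P. P \<in> \<Gamma> \<Longrightarrow> rep P \<in> P"
    using proj_space_nonempty[OF \<Gamma>_proj] by metis
  have "rep ` \<Gamma> \<subseteq> nonzero_vecs n" using proj_space_class(1)[OF \<Gamma>_proj rep] by blast
  then obtain c :: "nat \<Rightarrow> real" where c: "\<And>v. v \<in> rep ` \<Gamma> \<Longrightarrow> (\<Sum>i<n. of_real (c i) * v i) \<noteq> 0"
    using common_nonvanishing_linear_form[of "rep ` \<Gamma>" n] fin\<Gamma> by blast
  define L where "L = (\<lambda>v :: nat \<Rightarrow> complex. \<Sum>i<n. of_real (c i) * v i)"
  have L_scale: "L (\<lambda>i. k * v i) = k * L v" for k v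
    by (simp add: L_def sum_distrib_left mult_ac)
  have L_conj: "L (conj_vec v) = cnj (L v)" for v by (simp add: L_def)
  \<comment> \<open>\<open>L\<close> is nonzero at every point of \<open>\<Gamma>\<close>, so each
    point has exactly one vector with \<open>L v = 1\<close>. As \<open>L\<close> has real
    coefficients, this set is closed under conjugation.\<close>
  define S where "S = {v \<in> nonzero_vecs n. L v = 1 \<and> (\<forall>j\<in>{1..n - 1}. peval (f j) v = 0)}"
  define cl where "cl = (\<lambda>v. proj_rel n `` {v})"
  have S: "v \<in> nonzero_vecs n" "L v = 1" if "v \<in> S" for v using that by (auto simp: S_def)
  have bij: "bij_betw cl S \<Gamma>"
  proof (rule bij_betwI')
    fix v w assume vw: "v \<in> S" "w \<in> S"
    show "cl v = cl w \<longleftrightarrow> v = w"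
    proof
      assume "cl v = cl w"
      moreover have "w \<in> cl w"
        unfolding cl_def proj_class_iff[OF S(1)[OF vw(2)]] by (intro exI[of _ 1]) simp
      ultimately have "w \<in> cl v" by simp
      then obtain k where "w = (\<lambda>i. k * v i)"
        using iffD1[OF proj_class_iff[OF S(1)[OF vw(1)]]] unfolding cl_def by blast
      then show "v = w" using L_scale[of k v] S(2) vw by simp
    qed simp
  next
    fix v assume v: "v \<in> S"
    have "peval (f j) w = 0" if w: "w \<in> cl v" and j: "j \<in> {1..n - 1}" for w j
    proof -
      obtain k where "w = (\<lambda>i. k * v i)"
        using w iffD1[OF proj_class_iff[OF S(1)[OF v]]] unfolding cl_def by blast
      then show ?thesis using peval_scale[OF f[OF j], of k v] v j by (simp add: S_def)
    qed
    then show "cl v \<in> \<Gamma>"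
      using proj_class[OF S(1)[OF v]] unfolding assms(6) common_zeros_def cl_def by blast
  next
    fix P assume P: "P \<in> \<Gamma>"
    let ?w = "\<lambda>i. (1 / L (rep P)) * rep P i"
    have L0: "L (rep P) \<noteq> 0" using c P by (simp add: L_def)
    note rp = proj_space_class[OF \<Gamma>_proj[OF P] rep[OF P]]
    have "?w \<in> proj_rel n `` {rep P}"
      using L0 by (intro iffD2[OF proj_class_iff[OF rp(1)]] exI[of _ "1 / L (rep P)"]) simp
    then have w: "?w \<in> P" using rp(2) by simp
    have "L ?w = 1" unfolding L_scale using L0 by simp
    moreover have "peval (f j) ?w = 0" if "j \<in> {1..n - 1}" for j
      using P w that unfolding assms(6) common_zeros_def by blast
    ultimately have "?w \<in> S"
      using proj_space_class(1)[OF \<Gamma>_proj[OF P] w] unfolding S_def by blast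
    moreover have "P = cl ?w" unfolding cl_def by (rule proj_space_class(2)[OF \<Gamma>_proj[OF P] w])
    ultimately show "\<exists>v\<in>S. P = cl v" by blast
  qed
  have cardS: "card S = d ^ (n - 1)" and finS: "finite S"
    using bij_betw_same_card[OF bij] bij_betw_finite[OF bij] fin\<Gamma> assms(7) by auto
  have mem_cl: "v \<in> cl v" if "v \<in> S" for v
    unfolding cl_def proj_class_iff[OF S(1)[OF that]] by (intro exI[of _ 1]) simp
  have cl: "cl v \<in> \<Gamma>" if "v \<in> S" for v using bij that by (auto simp: bij_betw_def)
  \<comment> \<open>A real vector \<open>k * v\<close> in the class has \<open>L\<close>-value
    \<open>k\<close>, so \<open>k\<close> is real and therefore \<open>v\<close> is real
    too.\<close>
  have real_iff: "real_point (cl v) \<longleftrightarrow> conj_vec v = v" if v: "v \<in> S" for v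
  proof
    assume "real_point (cl v)"
    then obtain w where w: "w \<in> cl v" "\<And>i. w i \<in> \<real>" by (auto simp: real_point_def)
    then obtain k where k: "k \<noteq> 0" "w = (\<lambda>i. k * v i)"
      using iffD1[OF proj_class_iff[OF S(1)[OF v]]] unfolding cl_def by blast
    have "L w = k" using L_scale[of k v] S(2)[OF v] k by simp
    moreover have "conj_vec w = w" using w(2) by (auto simp: Reals_cnj_iff)
    ultimately have "cnj k = k" using L_conj[of w] by simp
    then have "k * cnj (v i) = k * v i" for i
      using fun_cong[OF \<open>conj_vec w = w\<close>, of i] k(2) by simp
    then show "conj_vec v = v" using k(1) by auto
  next
    assume "conj_vec v = v"
    then have "v i \<in> \<real>" for i by (auto simp: Reals_cnj_iff dest: fun_cong[of _ _ i])
    then show "real_point (cl v)" using mem_cl[OF v] unfolding real_point_def by blast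
  qed
  have conjS: "conj_vec v \<in> S" if "v \<in> S" for v
    using that conj_nonzero_vecs[of v n] unfolding S_def by (auto simp: L_conj peval_cnj)
  have conj_cl: "conj_point (cl v) = cl (conj_vec v)" if "v \<in> S" for v
    unfolding cl_def by (rule conj_point_class[OF S(1)[OF that]])
  interpret conj_closed_points n d f c S
  proof
    show "S \<noteq> {}" using cardS nd by auto
    show "v i = 0" if "v \<in> S" "n \<le> i" for v i using S(1)[OF that(1)] that(2) by (simp add: nonzero_vecs_def)
    show "(\<Sum>i<n. of_real (c i) * v i) = 1" if "v \<in> S" for v using S(2)[OF that] by (simp add: L_def)
    show "peval (f j) v = 0" if "v \<in> S" "j \<in> {1..n - 1}" for v j using that by (simp add: S_def)
    show "gradients_independent n f v" if "v \<in> S" for v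
      using assms(5) cl[OF that] mem_cl[OF that] unfolding intersect_transversely_def assms(6) by blast
    show "(n - 1) * (d - 1) = d + 1" using nd by auto
    \<comment> \<open>The dimensions in degrees \<open>d\<close> and \<open>2 * d\<close>, first for
      \<open>n = 3\<close> and then for \<open>n = 4\<close>.\<close>
    have "5 choose 3 = (10::nat)" "8 choose 6 = (28::nat)" "5 choose 2 = (10::nat)" "7 choose 4 = (35::nat)"
      by code_simp+
    then show "dim (forms n d) + 2 = card S + n"
      "dim (forms n (2 * d)) = (n - 1) * (card S - 1) + n * (n - 1) div 2 + card S"
      using nd unfolding dim_forms cardS by auto
  qed (use f finS conjS in auto)
  show ?thesis
  proof (rule ccontr)
    assume not: "\<not> ?thesis"
    then obtain \<gamma> where \<gamma>: "\<gamma> \<in> \<Gamma>" "\<not> real_point \<gamma>" by blast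
    then obtain v1 where v1: "v1 \<in> S" "\<gamma> = cl v1" using bij unfolding bij_betw_def by blast
    have "conj_point \<gamma> \<in> \<Gamma>" using conj_cl[OF v1(1)] cl[OF conjS[OF v1(1)]] v1(2) by simp
    \<comment> \<open>Failure of the second alternative provides a non-real point outside the first
      pair.\<close>
    then obtain \<delta> where \<delta>: "\<delta> \<in> \<Gamma>" "\<delta> \<noteq> \<gamma>" "\<delta> \<noteq> conj_point \<gamma>" "\<not> real_point \<delta>"
      using not \<gamma> by blast
    then obtain v2 where v2: "v2 \<in> S" "\<delta> = cl v2" using bij unfolding bij_betw_def by blast
    show False
    proof (rule at_most_one_conj_pair[OF assms(2,3) _ v1(1) _ v2(1)])
      show "f j \<in> qf_kernel (forms n d) (quad_form l)" if "j \<in> {1..n - 1}" for j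
        using assms(4) that by blast
      show "conj_vec v1 \<noteq> v1" using \<gamma>(2) real_iff[OF v1(1)] v1(2) by simp
      show "conj_vec v2 \<noteq> v2" using \<delta>(4) real_iff[OF v2(1)] v2(2) by simp
      show "v2 \<noteq> v1" using \<delta>(2) v1(2) v2(2) by blast
      show "v2 \<noteq> conj_vec v1" using \<delta>(3) v1 v2(2) conj_cl by metis
    qed
  qed
qed

end
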